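(* Let $a,b$ be real numbers with $\min(a,b)>2$. Then the collection $$\{L_{k,l}\mid k,l\in\mathbb{N},\ k\le\lfloor a\rfloor,\ l\le\lfloor b\rfloor\}$$ is not a maximal integral packing of $P(a,b)$; that is, there is an integral Lagrangian torus in $P(a,b)$ which is disjoint from every torus in the collection. Moreover, for every $\epsilon>0$ there is an integral Lagrangian torus $L^+$ contained in $$P(2+\epsilon,2+\epsilon)\smallsetminus\bigcup_{k,l\in\{1,2\}}L_{k,l}.$$
   Context: For $a,b>0$, $P(a,b)=\{(z_1,z_2)\in\mathbb{C}^2\mid \pi|z_1|^2<a,\ \pi|z_2|^2<b\}\subset\mathbb{R}^4$ is the symplectic polydisk, equipped with the standard symplectic form of $\mathbb{R}^4=\mathbb{C}^2$. Here $\mathbb{N}$ denotes the positive integers. For $k,l\in\mathbb{N}$, $L_{k,l}=\{(z_1,z_2)\mid \pi|z_1|^2=k,\ \pi|z_2|^2=l\}$ is the product of the circle about the origin bounding area $k$ in the $z_1$-plane with the circle about the origin bounding area $l$ in the $z_2$-plane. A Lagrangian torus $L$ in a symplectic manifold $(M,\Omega)$ is an embedded Lagrangian submanifold diffeomorphic to the $2$-torus (when $\dim M=4$). It is called integral if its area homomorphism $\Omega\colon\pi_2(M,L)\to\mathbb{R}$ takes only integer values. A collection of pairwise disjoint integral Lagrangian tori in $(M,\Omega)$ is called a maximal integral packing if any other integral Lagrangian torus in $M$ must intersect at least one torus in the collection. *)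

theory Defs
  imports "HOL-Analysis.Analysis"
begin

primrec Ck_on :: "nat \<Rightarrow> 'a set \<Rightarrow> ('a::real_normed_vector \<Rightarrow> 'b::real_normed_vector) \<Rightarrow> bool" where
  "Ck_on 0 S f \<longleftrightarrow> continuous_on S f"
| "Ck_on (Suc n) S f \<longleftrightarrow>
     (\<forall>x\<in>S. f differentiable (at x)) \<and>
     (\<forall>v. Ck_on n S (\<lambda>x. frechet_derivative f (at x) v))"

(* Intended for open S only. *)
definition smooth_on :: "'a set \<Rightarrow> ('a::real_normed_vector \<Rightarrow> 'b::real_normed_vector) \<Rightarrow> bool" where
  "smooth_on S f \<longleftrightarrow> (\<forall>n. Ck_on n S f)"

(* R^4 = C^2 is the type complex \<times> complex with z_j = x_j + i y_j.  Since
   Im (cnj v * w) = Re v * Im w - Im v * Re w, this is dx_1 \<and> dy_1 + dx_2 \<and> dy_2. *)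
definition std_symplectic :: "complex \<times> complex \<Rightarrow> complex \<times> complex \<Rightarrow> real" where
  "std_symplectic v w = Im (cnj (fst v) * fst w) + Im (cnj (snd v) * snd w)"

definition polydisk :: "real \<Rightarrow> real \<Rightarrow> (complex \<times> complex) set" where
  "polydisk a b = {(z1, z2). pi * (cmod z1)\<^sup>2 < a \<and> pi * (cmod z2)\<^sup>2 < b}"

definition product_torus :: "nat \<Rightarrow> nat \<Rightarrow> (complex \<times> complex) set" where
  "product_torus k l = {(z1, z2). pi * (cmod z1)\<^sup>2 = real k \<and> pi * (cmod z2)\<^sup>2 = real l}"

(* f is the Z^2-periodic lift to R^2 of a map R^2/Z^2 \<rightarrow> C^2.  The equivalence says that this
   map is well defined and injective; as the torus is compact, an injective immersion of it
   is an embedding. *)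
definition torus_embedding :: "(real \<times> real \<Rightarrow> complex \<times> complex) \<Rightarrow> bool" where
  "torus_embedding f \<longleftrightarrow>
     smooth_on UNIV f \<and>
     (\<forall>x y. f x = f y \<longleftrightarrow> fst x - fst y \<in> \<int> \<and> snd x - snd y \<in> \<int>) \<and>
     (\<forall>x. inj (frechet_derivative f (at x)))"

(* An embedded submanifold diffeomorphic to the 2-torus is the image of an embedding f of the
   2-torus; its tangent spaces are the images of the derivatives of f.  They have half the
   dimension of C^2, so Lagrangian means that the symplectic form vanishes on them. *)
definition lagrangian_torus :: "(complex \<times> complex) set \<Rightarrow> (complex \<times> complex) set \<Rightarrow> bool" where
  "lagrangian_torus M L \<longleftrightarrow>
     L \<subseteq> M \<and>
     (\<exists>f. torus_embedding f \<and> range f = L \<and>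
          (\<forall>x v w. std_symplectic (frechet_derivative f (at x) v)
                                  (frechet_derivative f (at x) w) = 0))"

definition based_discs ::
  "(complex \<times> complex) set \<Rightarrow> (complex \<times> complex) set \<Rightarrow> complex \<times> complex \<Rightarrow>
   (complex \<Rightarrow> complex \<times> complex) set" where
  "based_discs M L p =
     {u. continuous_on (cball 0 1) u \<and> u ` cball 0 1 \<subseteq> M \<and> u ` sphere 0 1 \<subseteq> L \<and> u 1 = p}"

(* The set underlying the relative homotopy group \<pi>_2(M,L,p): homotopy classes of maps of the
   triple (closed unit disc, unit circle, 1) to (M,L,p). *)
definition rel_pi2 ::
  "(complex \<times> complex) set \<Rightarrow> (complex \<times> complex) set \<Rightarrow> complex \<times> complex \<Rightarrow>
   (complex \<Rightarrow> complex \<times> complex) set set" where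
  "rel_pi2 M L p =
     based_discs M L p //
       {(u, v). u \<in> based_discs M L p \<and> v \<in> based_discs M L p \<and>
          homotopic_with (\<lambda>h. h ` sphere 0 1 \<subseteq> L \<and> h 1 = p)
            (top_of_set (cball 0 1)) (top_of_set M) u v}"

definition smooth_disc :: "(complex \<Rightarrow> complex \<times> complex) \<Rightarrow> bool" where
  "smooth_disc u \<longleftrightarrow> (\<exists>U. open U \<and> cball 0 1 \<subseteq> U \<and> smooth_on U u)"

(* The integral over the unit disc of the pullback of the symplectic form under u. *)
definition symplectic_area :: "(complex \<Rightarrow> complex \<times> complex) \<Rightarrow> real" where
  "symplectic_area u =
     integral (cball 0 1)
       (\<lambda>z. std_symplectic (frechet_derivative u (at z) 1) (frechet_derivative u (at z) \<i>))"

(* The graph of the area homomorphism \<pi>_2(M,L,p) \<rightarrow> R, which sends a class to the symplectic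
   area of any smooth representative.  For M open and L a Lagrangian torus, every class has
   smooth representatives, and by Stokes' theorem they all have the same area. *)
definition area_hom_graph ::
  "(complex \<times> complex) set \<Rightarrow> (complex \<times> complex) set \<Rightarrow> complex \<times> complex \<Rightarrow>
   ((complex \<Rightarrow> complex \<times> complex) set \<times> real) set" where
  "area_hom_graph M L p =
     {(c, symplectic_area u) | c u. c \<in> rel_pi2 M L p \<and> u \<in> c \<and> smooth_disc u}"

definition integral_lagrangian_torus ::
  "(complex \<times> complex) set \<Rightarrow> (complex \<times> complex) set \<Rightarrow> bool" where
  "integral_lagrangian_torus M L \<longleftrightarrow>
     lagrangian_torus M L \<and> (\<forall>p\<in>L. Range (area_hom_graph M L p) \<subseteq> \<int>)"

definition integral_packing ::
  "(complex \<times> complex) set \<Rightarrow> (complex \<times> complex) set set \<Rightarrow> bool" where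
  "integral_packing M \<C> \<longleftrightarrow>
     (\<forall>L\<in>\<C>. integral_lagrangian_torus M L) \<and> pairwise disjnt \<C>"

definition maximal_integral_packing ::
  "(complex \<times> complex) set \<Rightarrow> (complex \<times> complex) set set \<Rightarrow> bool" where
  "maximal_integral_packing M \<C> \<longleftrightarrow>
     integral_packing M \<C> \<and>
     (\<forall>L. integral_lagrangian_torus M L \<and> L \<notin> \<C> \<longrightarrow> (\<exists>L'\<in>\<C>. L \<inter> L' \<noteq> {}))"

(* When a (or b) is an integer, the tori with k = a (or l = b) lie on the boundary of
   polydisk a b, not inside it. *)
definition product_tori :: "real \<Rightarrow> real \<Rightarrow> (complex \<times> complex) set set" where
  "product_tori a b =
     {product_torus k l | k l. k \<ge> 1 \<and> l \<ge> 1 \<and> int k \<le> \<lfloor>a\<rfloor> \<and> int l \<le> \<lfloor>b\<rfloor>}"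

end

theory Submission
  imports Defs
begin

text \<open>
  Write \<open>A\<^sub>j = \<pi> |z\<^sub>j|\<^sup>2\<close> and \<open>\<theta>\<^sub>j = arg z\<^sub>j / 2\<pi>\<close>. In these action-angle coordinates the
  symplectic form is \<open>dA\<^sub>1 \<and> d\<theta>\<^sub>1 + dA\<^sub>2 \<and> d\<theta>\<^sub>2\<close>, and the torus with indices \<open>k, l\<close> is the whole fibre
  over \<open>(A\<^sub>1, A\<^sub>2) = (k, l)\<close>. It therefore suffices to find, for small \<open>\<epsilon>\<close>, one integral Lagrangian torus
  with actions in \<open>(0, 2 + \<epsilon>)\<close> on which \<open>(A\<^sub>1, A\<^sub>2)\<close> is never a pair of integers.

  An embedded closed curve of area 1 in the disc \<open>A\<^sub>2 < 2 + \<epsilon>\<close> cannot avoid both circles \<open>A\<^sub>2 = 1\<close> and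
  \<open>A\<^sub>2 = 2\<close>, but it can avoid either one of them: take \<open>(A\<^sub>2, \<theta>\<^sub>2) = (3/2 + x, y)\<close>, where \<open>(x, y)\<close> runs once around a curve of
  area 1 in the rectangle \<open>|x| < (1 + \<delta>)/2\<close>, \<open>|y| < 1/2\<close>, and push it a little in the \<open>A\<^sub>2\<close>-direction. The
  torus is swept out by this curve while \<open>\<theta>\<^sub>1 = t\<close> runs once around the circle. With \<open>c = cos 2\<pi>t\<close>, the
  curve is pushed by \<open>m(t) = 2\<delta>c\<close> and turned by the angle \<open>-K(t)\<close>, where
  \<open>K(t) = t - (\<eta>/\<pi>) sin 2\<pi>t\<close>. The torus is Lagrangian if \<open>A\<^sub>1 = b(t) + K'(t) x + m'(t) y\<close>, with an
  arbitrary periodic function \<open>b\<close>. The choice of \<open>b\<close> made here gives, up to the tiny term \<open>m'(t) y\<close>,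
    \<open>A\<^sub>1 = 1 + \<eta> (c\<^sup>2 + c - 1/2)\<close> where \<open>A\<^sub>2 = 1\<close>, and
    \<open>A\<^sub>1 = 2 + \<eta> (c\<^sup>2 - c - 1/2)\<close> where \<open>A\<^sub>2 = 2\<close>.
  Both corrections have mean value 0 in \<open>t\<close>, which is what integrality of the second period demands, and yet
  they are negative at every point that matters: the curve meets \<open>A\<^sub>2 = 1\<close> only when \<open>c < 1/4\<close>, and
  \<open>A\<^sub>2 = 2\<close> only when \<open>c > -1/4\<close>. So \<open>A\<^sub>1\<close> lies strictly between consecutive integers whenever \<open>A\<^sub>2\<close> is an
  integer (lemmas \<open>action1_if_action2_eq_1\<close> and \<open>action1_if_action2_eq_2\<close>).

  For integrality, the pullback of the Liouville form to the universal cover \<open>\<real>\<^sup>2\<close> has an explicit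
  primitive, which grows by 1 under one generator of the lattice and by 0 under the other
  (\<open>primitive_deriv\<close>, \<open>primitive_periods\<close>). By Stokes' theorem (\<open>stokes_disc\<close>) the area of a
  disc is the integral of the Liouville form over its boundary, and \<open>symplectic_area_integer\<close> shows
  that this integral is an integer as soon as such a primitive has integer periods. Both steps
  involve only the torus, which is therefore integral in every set that contains it.
\<close>

section \<open>Smooth maps built from elementary functions\<close>

text \<open>
  All coordinate functions of the torus belong to one class that is closed under partial derivatives; this
  makes smoothness a single induction instead of a calculus of \<open>Ck_on\<close>. The power rule asks for a
  positive base so that the class consists of functions that are smooth on the whole plane.
\<close>
inductive_set elementary :: "(real \<times> real \<Rightarrow> real) set" where
  const: "(\<lambda>_. c) \<in> elementary"
| fst: "fst \<in> elementary"
| snd: "snd \<in> elementary"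
| add: "d \<in> elementary \<Longrightarrow> e \<in> elementary \<Longrightarrow> (\<lambda>p. d p + e p) \<in> elementary"
| mult: "d \<in> elementary \<Longrightarrow> e \<in> elementary \<Longrightarrow> (\<lambda>p. d p * e p) \<in> elementary"
| sin: "e \<in> elementary \<Longrightarrow> (\<lambda>p. sin (e p)) \<in> elementary"
| cos: "e \<in> elementary \<Longrightarrow> (\<lambda>p. cos (e p)) \<in> elementary"
| powr: "e \<in> elementary \<Longrightarrow> (\<And>p. e p > 0) \<Longrightarrow> (\<lambda>p. e p powr r) \<in> elementary"

lemma elementary_minus: "e \<in> elementary \<Longrightarrow> (\<lambda>p. - e p) \<in> elementary"
  using elementary.mult[OF elementary.const[of "-1"]] by simp

lemma elementary_diff:
  "d \<in> elementary \<Longrightarrow> e \<in> elementary \<Longrightarrow> (\<lambda>p. d p - e p) \<in> elementary"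
  using elementary.add[OF _ elementary_minus] by force

lemma elementary_power: "e \<in> elementary \<Longrightarrow> (\<lambda>p. e p ^ n) \<in> elementary"
  by (induction n) (auto intro: elementary.intros)

lemma elementary_sqrt:
  assumes "e \<in> elementary" "\<And>p. e p > 0"
  shows "(\<lambda>p. sqrt (e p)) \<in> elementary"
  using elementary.powr[OF assms, of "1/2"] assms(2) by (simp add: powr_half_sqrt less_imp_le)

lemmas elementary_intros = elementary.intros elementary_minus elementary_diff elementary_power elementary_sqrt

lemma elementary_has_derivative:
  assumes "e \<in> elementary"
  shows "\<exists>d1\<in>elementary. \<exists>d2\<in>elementary.
           \<forall>p. (e has_derivative (\<lambda>v. fst v * d1 p + snd v * d2 p)) (at p)"
  using assms
proof induction
  case (const c)
  show ?case
    by (rule bexI[of _ "\<lambda>_. 0"], rule bexI[of _ "\<lambda>_. 0"]) (auto intro: elementary.const)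
next
  case fst
  show ?case
    by (rule bexI[of _ "\<lambda>_. 1"], rule bexI[of _ "\<lambda>_. 0"])
       (auto intro: elementary.const intro!: has_derivative_fst[OF has_derivative_ident, simplified])
next
  case snd
  show ?case
    by (rule bexI[of _ "\<lambda>_. 0"], rule bexI[of _ "\<lambda>_. 1"])
       (auto intro: elementary.const intro!: has_derivative_snd[OF has_derivative_ident, simplified])
next
  case (add d e)
  then obtain d1 d2 e1 e2
    where el: "d1 \<in> elementary" "d2 \<in> elementary" "e1 \<in> elementary" "e2 \<in> elementary"
      and d: "\<And>p. (d has_derivative (\<lambda>v. fst v * d1 p + snd v * d2 p)) (at p)"
             "\<And>p. (e has_derivative (\<lambda>v. fst v * e1 p + snd v * e2 p)) (at p)"
    by blast
  show ?case
    by (rule bexI[of _ "\<lambda>p. d1 p + e1 p"], rule bexI[of _ "\<lambda>p. d2 p + e2 p"])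
       (auto intro!: el elementary.intros derivative_eq_intros d simp: algebra_simps)
next
  case (mult d e)
  then obtain d1 d2 e1 e2
    where el: "d1 \<in> elementary" "d2 \<in> elementary" "e1 \<in> elementary" "e2 \<in> elementary"
      and d: "\<And>p. (d has_derivative (\<lambda>v. fst v * d1 p + snd v * d2 p)) (at p)"
             "\<And>p. (e has_derivative (\<lambda>v. fst v * e1 p + snd v * e2 p)) (at p)"
    by blast
  show ?case
    by (rule bexI[of _ "\<lambda>p. d1 p * e p + d p * e1 p"], rule bexI[of _ "\<lambda>p. d2 p * e p + d p * e2 p"])
       (auto intro!: el mult.hyps elementary.intros derivative_eq_intros d simp: algebra_simps)
next
  case (sin e)
  then obtain e1 e2 where el: "e1 \<in> elementary" "e2 \<in> elementary"
      and d: "\<And>p. (e has_derivative (\<lambda>v. fst v * e1 p + snd v * e2 p)) (at p)"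
    by blast
  show ?case
    by (rule bexI[of _ "\<lambda>p. cos (e p) * e1 p"], rule bexI[of _ "\<lambda>p. cos (e p) * e2 p"])
       (auto intro!: el sin.hyps elementary.intros derivative_eq_intros d simp: algebra_simps)
next
  case (cos e)
  then obtain e1 e2 where el: "e1 \<in> elementary" "e2 \<in> elementary"
      and d: "\<And>p. (e has_derivative (\<lambda>v. fst v * e1 p + snd v * e2 p)) (at p)"
    by blast
  show ?case
    by (rule bexI[of _ "\<lambda>p. - sin (e p) * e1 p"], rule bexI[of _ "\<lambda>p. - sin (e p) * e2 p"])
       (auto intro!: el cos.hyps elementary_intros derivative_eq_intros d simp: algebra_simps)
next
  case (powr e r)
  then obtain e1 e2 where el: "e1 \<in> elementary" "e2 \<in> elementary"
      and d: "\<And>p. (e has_derivative (\<lambda>v. fst v * e1 p + snd v * e2 p)) (at p)"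
    by blast
  have "((\<lambda>p. e p powr r) has_derivative
          (\<lambda>v. fst v * (r * e p powr (r - 1) * e1 p) + snd v * (r * e p powr (r - 1) * e2 p))) (at p)" for p
  proof -
    have "((\<lambda>u. u powr r) has_derivative (\<lambda>h. h * (r * e p powr (r - 1)))) (at (e p))"
      using has_real_derivative_powr[OF powr.hyps(2)[of p], of r]
      by (simp add: has_field_derivative_def mult_commute_abs)
    from has_derivative_compose[OF d this] show ?thesis
      by (simp add: algebra_simps)
  qed
  then show ?case
    by (intro bexI[of _ "\<lambda>p. r * e p powr (r - 1) * e1 p"] bexI[of _ "\<lambda>p. r * e p powr (r - 1) * e2 p"])
       (auto intro!: el powr.hyps elementary.intros)
qed

lemma has_derivative_Complex:
  assumes "(f has_derivative f') F" "(g has_derivative g') F"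
  shows "((\<lambda>x. Complex (f x) (g x)) has_derivative (\<lambda>v. Complex (f' v) (g' v))) F"
  unfolding Complex_eq
  by (intro derivative_intros has_derivative_of_real has_derivative_mult_right assms)

text \<open>
  The maps with elementary real and imaginary parts form a class that is closed under directional derivatives
  and consists of differentiable maps; every such class consists of smooth maps.
\<close>
lemma smooth_on_elementary:
  assumes "e1 \<in> elementary" "e2 \<in> elementary" "e3 \<in> elementary" "e4 \<in> elementary"
  shows "smooth_on UNIV (\<lambda>p. (Complex (e1 p) (e2 p), Complex (e3 p) (e4 p)))"
proof -
  define C :: "(real \<times> real \<Rightarrow> complex \<times> complex) set" where
    "C = {h. \<exists>e1\<in>elementary. \<exists>e2\<in>elementary. \<exists>e3\<in>elementary. \<exists>e4\<in>elementary.
           h = (\<lambda>p. (Complex (e1 p) (e2 p), Complex (e3 p) (e4 p)))}"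
  have step: "(\<forall>p. h differentiable (at p)) \<and> (\<forall>v. (\<lambda>p. frechet_derivative h (at p) v) \<in> C)"
    if hC: "h \<in> C" for h
  proof -
    obtain e1 e2 e3 e4 where el: "e1 \<in> elementary" "e2 \<in> elementary" "e3 \<in> elementary" "e4 \<in> elementary"
      and h: "h = (\<lambda>p. (Complex (e1 p) (e2 p), Complex (e3 p) (e4 p)))"
      using hC unfolding C_def by blast
    obtain a1 b1 where 1: "a1 \<in> elementary" "b1 \<in> elementary"
        "\<And>p. (e1 has_derivative (\<lambda>v. fst v * a1 p + snd v * b1 p)) (at p)"
      using elementary_has_derivative[OF el(1)] by blast
    obtain a2 b2 where 2: "a2 \<in> elementary" "b2 \<in> elementary"
        "\<And>p. (e2 has_derivative (\<lambda>v. fst v * a2 p + snd v * b2 p)) (at p)"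
      using elementary_has_derivative[OF el(2)] by blast
    obtain a3 b3 where 3: "a3 \<in> elementary" "b3 \<in> elementary"
        "\<And>p. (e3 has_derivative (\<lambda>v. fst v * a3 p + snd v * b3 p)) (at p)"
      using elementary_has_derivative[OF el(3)] by blast
    obtain a4 b4 where 4: "a4 \<in> elementary" "b4 \<in> elementary"
        "\<And>p. (e4 has_derivative (\<lambda>v. fst v * a4 p + snd v * b4 p)) (at p)"
      using elementary_has_derivative[OF el(4)] by blast
    have D: "(h has_derivative (\<lambda>v. (Complex (fst v * a1 p + snd v * b1 p) (fst v * a2 p + snd v * b2 p),
               Complex (fst v * a3 p + snd v * b3 p) (fst v * a4 p + snd v * b4 p)))) (at p)" for p
      unfolding h by (intro has_derivative_Pair has_derivative_Complex 1 2 3 4)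
    have "(\<lambda>p. frechet_derivative h (at p) v) \<in> C" for v
      unfolding C_def mem_Collect_eq frechet_derivative_at[OF D, symmetric]
      by (intro bexI[of _ "\<lambda>p. fst v * a1 p + snd v * b1 p"] bexI[of _ "\<lambda>p. fst v * a2 p + snd v * b2 p"]
          bexI[of _ "\<lambda>p. fst v * a3 p + snd v * b3 p"] bexI[of _ "\<lambda>p. fst v * a4 p + snd v * b4 p"])
         (auto intro!: elementary.intros 1 2 3 4)
    with D show ?thesis
      unfolding differentiable_def by blast
  qed
  have "Ck_on n UNIV h" if "h \<in> C" for n h
    using that
  proof (induction n arbitrary: h)
    case 0
    then show ?case
      using step by (auto intro!: differentiable_imp_continuous_on simp: differentiable_on_def
          intro: differentiable_at_withinI)
  next
    case (Suc n)
    then show ?case using step by auto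
  qed
  moreover have "(\<lambda>p. (Complex (e1 p) (e2 p), Complex (e3 p) (e4 p))) \<in> C"
    unfolding C_def using assms by blast
  ultimately show ?thesis
    unfolding smooth_on_def by blast
qed

section \<open>Action-angle coordinates\<close>

definition action_angle :: "real \<Rightarrow> real \<Rightarrow> complex" where
  "action_angle r \<theta> = rcis (sqrt (r / pi)) (2 * pi * \<theta>)"

lemma area_action_angle: "r \<ge> 0 \<Longrightarrow> pi * (cmod (action_angle r \<theta>))\<^sup>2 = r"
  by (simp add: action_angle_def)

lemma action_angle_eq_iff:
  assumes "r > 0" "r' > 0"
  shows "action_angle r \<theta> = action_angle r' \<theta>' \<longleftrightarrow> r = r' \<and> \<theta> - \<theta>' \<in> \<int>"
proof -
  have 1: "r = r'" if "action_angle r \<theta> = action_angle r' \<theta>'"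
    using area_action_angle[of r \<theta>] area_action_angle[of r' \<theta>'] assms that by auto
  have "action_angle r \<theta> = action_angle r \<theta>' \<longleftrightarrow> cis (2*pi*\<theta>) = cis (2*pi*\<theta>')"
    using assms by (simp add: action_angle_def rcis_def)
  also have "\<dots> \<longleftrightarrow> (\<exists>n. 2*pi*\<theta> = 2*pi*\<theta>' + 2 * pi * of_int n)"
    unfolding complex_eq_iff cis.sel using sin_cos_eq_iff[of "2*pi*\<theta>" "2*pi*\<theta>'"]
    by (simp add: conj_commute mult_ac)
  also have "\<dots> \<longleftrightarrow> (\<exists>n. \<theta> - \<theta>' = of_int n)"
  proof -
    have "(2*pi*\<theta> = 2*pi*\<theta>' + 2 * pi * of_int n) = (\<theta> - \<theta>' = of_int n)" for n
    proof -
      have "2*pi*\<theta>' + 2 * pi * of_int n = 2*pi*(\<theta>' + of_int n)" by (simp add: algebra_simps)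
      then show ?thesis by auto
    qed
    then show ?thesis by simp
  qed
  finally show ?thesis using 1 by (auto simp: Ints_def)
qed

text \<open>
  The logarithmic derivative of \<open>sqrt (r / \<pi>) exp (2 \<pi> \<i> \<theta>)\<close> is \<open>dr / 2r + 2 \<pi> \<i> d\<theta>\<close>. With the
  derivative written as a product with this complex number, the values of the symplectic form and of its
  radial primitive can be read off from that factor.
\<close>
lemma has_derivative_action_angle:
  fixes r \<theta> :: "'a::real_normed_vector \<Rightarrow> real"
  assumes r: "(r has_derivative r') (at p)" and \<theta>: "(\<theta> has_derivative \<theta>') (at p)" and pos: "r p > 0"
  shows "((\<lambda>p. action_angle (r p) (\<theta> p)) has_derivative
           (\<lambda>v. action_angle (r p) (\<theta> p) * Complex (r' v / (2 * r p)) (2 * pi * \<theta>' v))) (at p)"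
proof -
  have q: "sqrt (r p) > 0" "sqrt (r p) * sqrt (r p) = r p" using pos by auto
  have "((\<lambda>p. sqrt (r p / pi)) has_derivative (\<lambda>v. sqrt (r p / pi) * (r' v / (2 * r p)))) (at p)"
    using q pos
    by (auto intro!: derivative_eq_intros r ext simp: real_sqrt_divide field_simps)
  moreover have "((\<lambda>p. cis (2*pi*\<theta> p)) has_derivative (\<lambda>v. (2*pi*\<theta>' v) *\<^sub>R (\<i> * cis (2*pi*\<theta> p)))) (at p)"
    by (auto intro!: derivative_eq_intros \<theta>)
  ultimately show ?thesis
    unfolding action_angle_def rcis_def
    by (rule has_derivative_eq_rhs[OF has_derivative_mult[OF has_derivative_of_real]])
       (auto simp: complex_eq_iff algebra_simps)
qed

text \<open>
  Because \<open>|z|\<^sup>2 = r / \<pi>\<close>, the area form of the plane becomes \<open>dr \<and> d\<theta>\<close> and its radial primitive becomes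
  \<open>r d\<theta>\<close>.
\<close>
lemma action_angle_forms:
  fixes r \<theta> :: real
  assumes "r > 0"
  defines "z \<equiv> action_angle r \<theta>"
  shows "Im (cnj (z * Complex (a / (2 * r)) (2 * pi * b)) * (z * Complex (a' / (2 * r)) (2 * pi * b'))) = a * b' - b * a'"
    and "Im (cnj z * (z * Complex (a / (2 * r)) (2 * pi * b))) = 2 * (r * b)"
    and "z \<noteq> 0"
proof -
  have n: "cnj z * z = of_real (r / pi)"
    using assms by (simp add: z_def action_angle_def complex_norm_square[symmetric] mult.commute flip: of_real_power of_real_mult of_real_divide)
  have prod: "cnj (z * A) * (z * B) = of_real (r / pi) * (cnj A * B)" for A B
    unfolding n[symmetric] by (simp add: mult_ac)
  show "Im (cnj (z * Complex (a / (2 * r)) (2 * pi * b)) * (z * Complex (a' / (2 * r)) (2 * pi * b'))) = a * b' - b * a'"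
    unfolding prod using assms(1) by (simp add: field_simps)
  show "Im (cnj z * (z * Complex (a / (2 * r)) (2 * pi * b))) = 2 * (r * b)"
    using prod[of 1 "Complex (a / (2 * r)) (2 * pi * b)"] by simp
  show "z \<noteq> 0" using assms(1) by (simp add: z_def action_angle_def)
qed

lemma elementary_action_angle:
  assumes "r \<in> elementary" "\<And>p. r p > 0" "\<theta> \<in> elementary"
  shows "(\<lambda>p. Re (action_angle (r p) (\<theta> p))) \<in> elementary"
    and "(\<lambda>p. Im (action_angle (r p) (\<theta> p))) \<in> elementary"
proof -
  have *: "(\<lambda>p. sqrt (r p / pi)) \<in> elementary"
    using elementary_sqrt[OF elementary.mult[OF assms(1) elementary.const[of "1/pi"]]] assms(2) by simp
  show "(\<lambda>p. Re (action_angle (r p) (\<theta> p))) \<in> elementary" "(\<lambda>p. Im (action_angle (r p) (\<theta> p))) \<in> elementary"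
    unfolding action_angle_def rcis_def by (auto intro!: elementary_intros * assms)
qed

lemma cos_sin_2pi_eq_iff:
  "cos (2 * pi * s) = cos (2*pi*t) \<and> sin (2 * pi * s) = sin (2*pi*t) \<longleftrightarrow> s - t \<in> \<int>"
  using action_angle_eq_iff[of 1 1 s t]
  by (simp add: action_angle_def rcis_def complex_eq_iff)

section \<open>Green's and Stokes' theorem on the unit disc\<close>

text \<open>
  Two applications of the mean value theorem turn the second difference over the parallelogram spanned by
  \<open>h v\<close> and \<open>h w\<close> into a second derivative at an interior point. The left-hand side is symmetric in \<open>v\<close> and
  \<open>w\<close>, so the same lemma applies with their roles exchanged.
\<close>
lemma second_difference_mean_value:
  fixes f :: "'a::real_normed_vector \<Rightarrow> real"
  assumes f: "\<And>x. x \<in> U \<Longrightarrow> (f has_derivative f' x) (at x)"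
    and fv: "\<And>x. x \<in> U \<Longrightarrow> ((\<lambda>x. f' x v) has_derivative fv x) (at x)"
    and h: "h > 0"
    and sub: "\<And>s t. 0 \<le> s \<Longrightarrow> s \<le> h \<Longrightarrow> 0 \<le> t \<Longrightarrow> t \<le> h \<Longrightarrow> a + s *\<^sub>R v + t *\<^sub>R w \<in> U"
  shows "\<exists>s t. 0 < s \<and> s < h \<and> 0 < t \<and> t < h \<and>
           f (a + h *\<^sub>R v + h *\<^sub>R w) - f (a + h *\<^sub>R v) - f (a + h *\<^sub>R w) + f a
             = h * h * fv (a + s *\<^sub>R v + t *\<^sub>R w) w"
proof -
  have line: "((\<lambda>s. f (b + s *\<^sub>R v)) has_real_derivative f' (b + s *\<^sub>R v) v) (at s)"
    if "b + s *\<^sub>R v \<in> U" for b s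
  proof -
    have "((\<lambda>s. b + s *\<^sub>R v) has_derivative (\<lambda>k. k *\<^sub>R v)) (at s)"
      by (auto intro!: derivative_eq_intros)
    from has_derivative_compose[OF this f[OF that]] show ?thesis
      using linear_scale[OF has_derivative_linear[OF f[OF that]]]
      by (simp add: has_field_derivative_def mult_commute_abs)
  qed
  let ?g = "\<lambda>s. f (a + h *\<^sub>R w + s *\<^sub>R v) - f (a + s *\<^sub>R v)"
  have "\<exists>s>0. s < h \<and> ?g h - ?g 0 = (h - 0) * (f' (a + h *\<^sub>R w + s *\<^sub>R v) v - f' (a + s *\<^sub>R v) v)"
  proof (rule MVT2[OF h])
    fix s assume "0 \<le> s" "s \<le> h"
    then show "DERIV ?g s :> f' (a + h *\<^sub>R w + s *\<^sub>R v) v - f' (a + s *\<^sub>R v) v"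
      using sub[of s h] sub[of s 0] h by (intro DERIV_diff line) (auto simp: algebra_simps)
  qed
  then obtain s where s: "0 < s" "s < h"
    "?g h - ?g 0 = h * (f' (a + h *\<^sub>R w + s *\<^sub>R v) v - f' (a + s *\<^sub>R v) v)"
    by auto
  let ?k = "\<lambda>t. f' (a + s *\<^sub>R v + t *\<^sub>R w) v"
  have "\<exists>t>0. t < h \<and> ?k h - ?k 0 = (h - 0) * fv (a + s *\<^sub>R v + t *\<^sub>R w) w"
  proof (rule MVT2[OF h])
    fix t assume "0 \<le> t" "t \<le> h"
    then have U: "a + s *\<^sub>R v + t *\<^sub>R w \<in> U" using s sub by auto
    have "((\<lambda>t. a + s *\<^sub>R v + t *\<^sub>R w) has_derivative (\<lambda>k. k *\<^sub>R w)) (at t)"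
      by (auto intro!: derivative_eq_intros)
    from has_derivative_compose[OF this fv[OF U]]
    show "DERIV ?k t :> fv (a + s *\<^sub>R v + t *\<^sub>R w) w"
      using linear_scale[OF has_derivative_linear[OF fv[OF U]]]
      by (simp add: has_field_derivative_def mult_commute_abs)
  qed
  then obtain t where t: "0 < t" "t < h" "?k h - ?k 0 = h * fv (a + s *\<^sub>R v + t *\<^sub>R w) w"
    by auto
  show ?thesis
    using s t by (intro exI[of _ s] exI[of _ t]) (simp add: algebra_simps)
qed

text \<open>
  Both second derivatives are limits of the same second differences divided by \<open>h\<^sup>2\<close>.
\<close>
lemma mixed_derivatives_commute:
  fixes f :: "'a::real_normed_vector \<Rightarrow> real"
  assumes U: "open U" "a \<in> U"
    and f: "\<And>x. x \<in> U \<Longrightarrow> (f has_derivative f' x) (at x)"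
    and fv: "\<And>x. x \<in> U \<Longrightarrow> ((\<lambda>x. f' x v) has_derivative fv x) (at x)"
    and fw: "\<And>x. x \<in> U \<Longrightarrow> ((\<lambda>x. f' x w) has_derivative fw x) (at x)"
    and cont: "isCont (\<lambda>x. fv x w) a" "isCont (\<lambda>x. fw x v) a"
  shows "fv a w = fw a v"
proof -
  have "dist (fv a w) (fw a v) \<le> 0 + e" if "e > 0" for e
  proof -
    have e2: "e / 2 > 0" using that by simp
    obtain d1 where d1: "d1 > 0" "\<And>x. dist x a < d1 \<Longrightarrow> dist (fv x w) (fv a w) < e / 2"
      using cont(1) e2 unfolding continuous_at_eps_delta by blast
    obtain d2 where d2: "d2 > 0" "\<And>x. dist x a < d2 \<Longrightarrow> dist (fw x v) (fw a v) < e / 2"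
      using cont(2) e2 unfolding continuous_at_eps_delta by blast
    obtain r where r: "r > 0" "ball a r \<subseteq> U" using U open_contains_ball by blast
    define d where "d = min r (min d1 d2)"
    define h where "h = d / (norm v + norm w + 1)"
    have d: "d > 0" unfolding d_def using d1 d2 r by simp
    have n: "norm v + norm w + 1 > 0" by (simp add: add_nonneg_pos)
    have h: "h > 0" unfolding h_def using d n by simp
    \<comment> \<open>the whole parallelogram lies in the ball of radius \<open>d\<close> around \<open>a\<close>\<close>
    have close: "dist (a + s *\<^sub>R v + t *\<^sub>R w) a < d" "dist (a + t *\<^sub>R w + s *\<^sub>R v) a < d"
      if "0 \<le> s" "s \<le> h" "0 \<le> t" "t \<le> h" for s t
    proof -
      have "norm (s *\<^sub>R v + t *\<^sub>R w) \<le> norm (s *\<^sub>R v) + norm (t *\<^sub>R w)" by (rule norm_triangle_ineq)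
      also have "\<dots> \<le> h * norm v + h * norm w"
        using that by (auto intro!: add_mono mult_right_mono)
      also have "\<dots> < h * (norm v + norm w + 1)" using h by (simp add: algebra_simps)
      also have "\<dots> = d" using n by (simp add: h_def)
      finally show "dist (a + s *\<^sub>R v + t *\<^sub>R w) a < d" "dist (a + t *\<^sub>R w + s *\<^sub>R v) a < d"
        by (simp_all add: dist_norm algebra_simps)
    qed
    have inU: "x \<in> U" if "dist x a < d" for x
      using that r by (auto simp: d_def dist_commute)
    obtain s t where 1: "0 < s" "s < h" "0 < t" "t < h"
        "f (a + h *\<^sub>R v + h *\<^sub>R w) - f (a + h *\<^sub>R v) - f (a + h *\<^sub>R w) + f a
           = h * h * fv (a + s *\<^sub>R v + t *\<^sub>R w) w"
      using second_difference_mean_value[of U f f' v fv h a w] f fv h close(1) inU by blast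
    obtain s' t' where 2: "0 < s'" "s' < h" "0 < t'" "t' < h"
        "f (a + h *\<^sub>R w + h *\<^sub>R v) - f (a + h *\<^sub>R w) - f (a + h *\<^sub>R v) + f a
           = h * h * fw (a + s' *\<^sub>R w + t' *\<^sub>R v) v"
      using second_difference_mean_value[of U f f' w fw h a v] f fw h close(2) inU by blast
    have "h * h * fv (a + s *\<^sub>R v + t *\<^sub>R w) w = h * h * fw (a + s' *\<^sub>R w + t' *\<^sub>R v) v"
      using 1(5) 2(5) by (simp add: algebra_simps)
    then have eq: "fv (a + s *\<^sub>R v + t *\<^sub>R w) w = fw (a + s' *\<^sub>R w + t' *\<^sub>R v) v"
      using h by simp
    have "dist (a + s *\<^sub>R v + t *\<^sub>R w) a < d1" "dist (a + s' *\<^sub>R w + t' *\<^sub>R v) a < d2"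
      using close(1)[of s t] close(2)[of t' s'] 1 2 by (auto simp: d_def)
    then have "dist (fv (a + s *\<^sub>R v + t *\<^sub>R w) w) (fv a w) < e / 2"
      "dist (fw (a + s' *\<^sub>R w + t' *\<^sub>R v) v) (fw a v) < e / 2"
      using d1 d2 by auto
    then show ?thesis unfolding eq dist_real_def by linarith
  qed
  then have "dist (fv a w) (fw a v) \<le> 0" by (rule field_le_epsilon)
  then show ?thesis by simp
qed

lemma lborel_complex: "lborel = distr (lborel \<Otimes>\<^sub>M lborel) borel (\<lambda>(x, y). Complex x y)"
proof (rule lborel_eqI)
  have meas: "(\<lambda>(x, y). Complex x y) \<in> borel_measurable (lborel \<Otimes>\<^sub>M lborel)"
    unfolding lborel_prod Complex_eq split_beta
    by (auto intro!: borel_measurable_continuous_onI continuous_intros)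
  fix l u :: complex assume lu: "\<And>b. b \<in> Basis \<Longrightarrow> l \<bullet> b \<le> u \<bullet> b"
  have "emeasure (distr (lborel \<Otimes>\<^sub>M lborel) borel (\<lambda>(x, y). Complex x y)) (box l u)
      = emeasure (lborel \<Otimes>\<^sub>M lborel) ({Re l <..< Re u} \<times> {Im l <..< Im u})"
    by (subst emeasure_distr[OF meas])
       (auto intro!: arg_cong2[where f=emeasure] simp: space_pair_measure in_box_complex_iff)
  also have "\<dots> = emeasure lborel {Re l <..< Re u} * emeasure lborel {Im l <..< Im u}"
    by (rule lborel.emeasure_pair_measure_Times) auto
  also have "\<dots> = ennreal (\<Prod>b\<in>Basis. (u - l) \<bullet> b)"
    using lu[of 1] lu[of \<i>] by (simp add: Basis_complex_def ennreal_mult)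
  finally show "emeasure (distr (lborel \<Otimes>\<^sub>M lborel) borel (\<lambda>(x, y). Complex x y)) (box l u)
      = ennreal (\<Prod>b\<in>Basis. (u - l) \<bullet> b)" .
qed simp

lemma integral_complex_iterated:
  fixes f :: "complex \<Rightarrow> real"
  assumes "integrable lborel f"
  shows "(LBINT z. f z) = (LBINT y. LBINT x. f (Complex x y))"
    and "(LBINT z. f z) = (LBINT x. LBINT y. f (Complex x y))"
proof -
  have meas: "(\<lambda>(x, y). Complex x y) \<in> borel_measurable (lborel \<Otimes>\<^sub>M lborel)"
    unfolding lborel_prod Complex_eq split_beta
    by (auto intro!: borel_measurable_continuous_onI continuous_intros)
  have f: "f \<in> borel_measurable borel" using assms by auto
  have int: "integrable (lborel \<Otimes>\<^sub>M lborel) (\<lambda>(x, y). f (Complex x y))"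
    using integrable_distr_eq[OF meas f] lborel_complex assms by (simp add: case_prod_beta')
  have eq: "(LBINT z. f z) = integral\<^sup>L (lborel \<Otimes>\<^sub>M lborel) (\<lambda>(x, y). f (Complex x y))"
    by (subst lborel_complex, subst integral_distr[OF meas f]) (simp add: case_prod_beta')
  show "(LBINT z. f z) = (LBINT y. LBINT x. f (Complex x y))"
    using lborel_pair.integral_snd[OF int] eq by simp
  show "(LBINT z. f z) = (LBINT x. LBINT y. f (Complex x y))"
    using lborel_pair.integral_fst[OF int] eq by simp
qed

text \<open>
  Fubini and the fundamental theorem of calculus on each chord of the disc. The map \<open>T\<close> stands for
  \<open>Complex x y\<close> or \<open>Complex y x\<close>, so that the chords may be taken in either direction.
\<close>
lemma integral_disc_directional_derivative:
  fixes g h :: "complex \<Rightarrow> real" and T :: "real \<Rightarrow> real \<Rightarrow> complex"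
  assumes iterated: "\<And>f::complex \<Rightarrow> real. integrable lborel f \<Longrightarrow> (LBINT z. f z) = (LBINT y. LBINT x. f (T x y))"
    and T: "continuous_on UNIV (\<lambda>(x, y). T x y)" "\<And>x y. (cmod (T x y))\<^sup>2 = x\<^sup>2 + y\<^sup>2"
    and g: "continuous_on (cball 0 1) g" and h: "continuous_on (cball 0 1) h"
    and der: "\<And>x y. T x y \<in> cball 0 1 \<Longrightarrow> ((\<lambda>x. g (T x y)) has_real_derivative h (T x y)) (at x)"
  shows "integral (cball 0 1) h
       = integral {-1..1} (\<lambda>y. g (T (sqrt (1 - y\<^sup>2)) y)) - integral {-1..1} (\<lambda>y. g (T (- sqrt (1 - y\<^sup>2)) y))"
proof -
  let ?D = "cball 0 1 :: complex set"
  let ?r = "\<lambda>y::real. sqrt (1 - y\<^sup>2)"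
  have inD: "T x y \<in> ?D \<longleftrightarrow> x\<^sup>2 + y\<^sup>2 \<le> 1" for x y
    by (simp add: abs_square_le_1 flip: T(2))
  have cT: "continuous_on A (\<lambda>x. T (a x) (b x))" if "continuous_on A a" "continuous_on A b"
    for A :: "real set" and a b
    using continuous_on_compose2[OF T(1) continuous_on_Pair[OF that]] by simp
  have int: "set_integrable lborel ?D h"
    unfolding set_integrable_def by (rule borel_integrable_compact) (auto intro: h)
  have inner: "(LBINT x. indicator ?D (T x y) *\<^sub>R h (T x y))
      = indicator {-1..1} y *\<^sub>R (g (T (?r y) y) - g (T (- ?r y) y))" for y
  proof (cases "y \<in> {-1..1}")
    case True
    then have y: "y\<^sup>2 \<le> 1" by (simp add: abs_square_le_1 abs_le_iff)
    have ind: "indicator ?D (T x y) = (indicator {- ?r y..?r y} x :: real)" for x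
    proof -
      have "x\<^sup>2 + y\<^sup>2 \<le> 1 \<longleftrightarrow> \<bar>x\<bar> \<le> ?r y"
        using y real_sqrt_le_iff[of "x\<^sup>2" "1 - y\<^sup>2"] by (simp add: algebra_simps)
      then show ?thesis unfolding indicator_def inD by (auto simp: abs_le_iff)
    qed
    have memb: "T x y \<in> ?D" if "x \<in> {- ?r y..?r y}" for x
      using ind[of x] that by (auto simp: indicator_def split: if_splits)
    have cont: "continuous_on {- ?r y..?r y} (\<lambda>x. h (T x y))"
      by (rule continuous_on_compose2[OF h cT]) (use memb in \<open>auto intro!: continuous_intros\<close>)
    have "set_integrable lborel {- ?r y..?r y} (\<lambda>x. h (T x y))"
      unfolding set_integrable_def by (rule borel_integrable_compact) (auto intro: cont)
    from set_borel_integral_eq_integral(2)[OF this]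
    have "(LBINT x. indicator ?D (T x y) *\<^sub>R h (T x y)) = integral {- ?r y..?r y} (\<lambda>x. h (T x y))"
      by (simp add: ind set_lebesgue_integral_def)
    also have "\<dots> = g (T (?r y) y) - g (T (- ?r y) y)"
    proof (rule integral_unique, rule fundamental_theorem_of_calculus)
      show "- ?r y \<le> ?r y" using y by simp
      fix x assume "x \<in> {- ?r y..?r y}"
      from der[OF memb[OF this]]
      show "((\<lambda>x. g (T x y)) has_vector_derivative h (T x y)) (at x within {- ?r y..?r y})"
        by (simp add: has_real_derivative_iff_has_vector_derivative has_vector_derivative_at_within)
    qed
    finally show ?thesis using True by simp
  next
    case False
    then have "1 < y\<^sup>2" by (metis abs_square_le_1 abs_le_iff atLeastAtMost_iff minus_le_iff not_le)
    then have "T x y \<notin> ?D" for x unfolding inD using zero_le_power2[of x] by linarith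
    then have "indicator ?D (T x y) = (0::real)" for x by (simp add: indicator_def)
    then show ?thesis using False by simp
  qed
  have bd: "T (?r y) y \<in> ?D" "T (- ?r y) y \<in> ?D" if "y \<in> {-1..1}" for y
    using that unfolding inD by (auto simp: abs_square_le_1 abs_le_iff)
  have cont1: "continuous_on {-1..1} (\<lambda>y. g (T (?r y) y))"
    by (rule continuous_on_compose2[OF g cT]) (use bd in \<open>auto intro!: continuous_intros\<close>)
  have cont2: "continuous_on {-1..1} (\<lambda>y. g (T (- ?r y) y))"
    by (rule continuous_on_compose2[OF g cT]) (use bd in \<open>auto intro!: continuous_intros\<close>)
  let ?F = "\<lambda>y. g (T (?r y) y) - g (T (- ?r y) y)"
  have "set_integrable lborel {-1..1} ?F"
    unfolding set_integrable_def
    by (rule borel_integrable_compact) (auto intro!: continuous_on_diff cont1 cont2)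
  from set_borel_integral_eq_integral(2)[OF this]
  have outer: "(LBINT y. indicator {-1..1} y *\<^sub>R ?F y) = integral {-1..1} ?F"
    by (simp add: set_lebesgue_integral_def)
  have "integral ?D h = (LBINT z. indicator ?D z *\<^sub>R h z)"
    using set_borel_integral_eq_integral(2)[OF int] by (simp add: set_lebesgue_integral_def)
  also have "\<dots> = (LBINT y. LBINT x. indicator ?D (T x y) *\<^sub>R h (T x y))"
    by (rule iterated) (use int in \<open>simp add: set_integrable_def\<close>)
  also have "\<dots> = integral {-1..1} ?F" by (simp only: inner outer)
  also have "\<dots> = integral {-1..1} (\<lambda>y. g (T (?r y) y)) - integral {-1..1} (\<lambda>y. g (T (- ?r y) y))"
    by (rule integral_diff) (auto intro!: integrable_continuous_real cont1 cont2)
  finally show ?thesis .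
qed

lemma integral_periodic_shift:
  fixes f :: "real \<Rightarrow> real"
  assumes f: "continuous_on UNIV f" and per: "\<And>x. f (x + p) = f x" and c: "0 \<le> c" "c \<le> p"
  shows "integral {-c..p - c} f = integral {0..p} f"
proof -
  have int: "f integrable_on {a..b}" for a b
    by (rule integrable_continuous_real) (rule continuous_on_subset[OF f], simp)
  have "integral {-c..p - c} f = integral {-c..0} f + integral {0..p - c} f"
    using c by (intro Henstock_Kurzweil_Integration.integral_combine[symmetric] int) auto
  moreover have "integral {0..p} f = integral {0..p - c} f + integral {p - c..p} f"
    using c by (intro Henstock_Kurzweil_Integration.integral_combine[symmetric] int) auto
  moreover have "integral {-c..0} (f \<circ> (\<lambda>x. x + p)) = integral {-c + p..0 + p} f"
    by (rule integral_shift) (rule continuous_on_subset[OF f], simp)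
  then have "integral {-c..0} f = integral {p - c..p} f"
    by (simp add: o_def per algebra_simps)
  ultimately show ?thesis by simp
qed

text \<open>
  The end points of the horizontal chords sweep out the right and the left half of the circle; substituting
  \<open>y = sin \<theta>\<close> on each half gives an integral over \<open>[-\<pi>/2, 3\<pi>/2]\<close>, which is then shifted.
\<close>
lemma green_disc_Re:
  fixes g h :: "complex \<Rightarrow> real"
  assumes g: "continuous_on (cball 0 1) g" and h: "continuous_on (cball 0 1) h"
    and der: "\<And>x y. Complex x y \<in> cball 0 1 \<Longrightarrow> ((\<lambda>x. g (Complex x y)) has_real_derivative h (Complex x y)) (at x)"
  shows "integral (cball 0 1) h = integral {0..2*pi} (\<lambda>\<theta>. g (cis \<theta>) * cos \<theta>)"
proof -
  let ?r = "\<lambda>y::real. sqrt (1 - y\<^sup>2)"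
  have r: "Complex (?r y) y \<in> cball 0 1" "Complex (- ?r y) y \<in> cball 0 1" if "y \<in> {-1..1}" for y
    using that by (auto simp: cmod_def abs_square_le_1 abs_le_iff)
  have c1: "continuous_on {-1..1} (\<lambda>y. g (Complex (?r y) y))"
    by (rule continuous_on_compose2[OF g]) (use r in \<open>auto intro!: continuous_intros simp: Complex_eq\<close>)
  have c2: "continuous_on {-1..1} (\<lambda>y. g (Complex (- ?r y) y))"
    by (rule continuous_on_compose2[OF g]) (use r in \<open>auto intro!: continuous_intros simp: Complex_eq\<close>)
  have cg: "continuous_on A (\<lambda>\<theta>. g (cis \<theta>) * cos \<theta>)" for A
    by (intro continuous_on_mult continuous_on_compose2[OF g]) (auto intro!: continuous_intros)
  have "integral (cball 0 1) h
      = integral {-1..1} (\<lambda>y. g (Complex (?r y) y)) - integral {-1..1} (\<lambda>y. g (Complex (- ?r y) y))"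
    by (rule integral_disc_directional_derivative[OF integral_complex_iterated(1) _ _ g h der])
       (auto simp: Complex_eq split_beta cmod_power2 intro!: continuous_intros)
  also have "integral {-1..1} (\<lambda>y. g (Complex (?r y) y)) = integral {-(pi/2)..pi/2} (\<lambda>\<theta>. g (cis \<theta>) * cos \<theta>)"
  proof -
    have "((\<lambda>\<theta>. cos \<theta> *\<^sub>R g (Complex (?r (sin \<theta>)) (sin \<theta>))) has_integral
        (integral {sin (-(pi/2))..sin (pi/2)} (\<lambda>y. g (Complex (?r y) y)))) {-(pi/2)..pi/2}"
      by (rule has_integral_substitution[where c="-1" and d=1])
         (auto intro!: c1 derivative_eq_intros)
    then have "integral {-1..1} (\<lambda>y. g (Complex (?r y) y))
        = integral {-(pi/2)..pi/2} (\<lambda>\<theta>. cos \<theta> *\<^sub>R g (Complex (?r (sin \<theta>)) (sin \<theta>)))"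
      by (simp add: integral_unique)
    also have "\<dots> = integral {-(pi/2)..pi/2} (\<lambda>\<theta>. g (cis \<theta>) * cos \<theta>)"
      by (rule integral_cong) (auto simp: cos_squared_eq[symmetric] cos_ge_zero cis.code)
    finally show ?thesis .
  qed
  also have "integral {-1..1} (\<lambda>y. g (Complex (- ?r y) y)) = - integral {pi/2..3*pi/2} (\<lambda>\<theta>. g (cis \<theta>) * cos \<theta>)"
  proof -
    have s: "sin (3*pi/2) = -1" using sin_3over2_pi by simp
    have "((\<lambda>\<theta>. cos \<theta> *\<^sub>R g (Complex (- ?r (sin \<theta>)) (sin \<theta>))) has_integral
        (integral {sin (pi/2)..sin (3*pi/2)} (\<lambda>y. g (Complex (- ?r y) y)) -
         integral {sin (3*pi/2)..sin (pi/2)} (\<lambda>y. g (Complex (- ?r y) y)))) {pi/2..3*pi/2}"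
      by (rule has_integral_substitution_general[where c="-1" and d=1 and s="{}"])
         (auto intro!: c2 derivative_eq_intros continuous_intros)
    then have "integral {-1..1} (\<lambda>y. g (Complex (- ?r y) y))
        = - integral {pi/2..3*pi/2} (\<lambda>\<theta>. cos \<theta> *\<^sub>R g (Complex (- ?r (sin \<theta>)) (sin \<theta>)))"
      by (simp add: integral_unique s)
    also have "integral {pi/2..3*pi/2} (\<lambda>\<theta>. cos \<theta> *\<^sub>R g (Complex (- ?r (sin \<theta>)) (sin \<theta>)))
        = integral {pi/2..3*pi/2} (\<lambda>\<theta>. g (cis \<theta>) * cos \<theta>)"
    proof (rule integral_cong)
      fix \<theta> assume "\<theta> \<in> {pi/2..3*pi/2}"
      then have "cos (\<theta> - pi) \<ge> 0" by (intro cos_ge_zero) (auto simp: field_simps)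
      then have "cos \<theta> \<le> 0" by (simp add: cos_diff)
      then show "cos \<theta> *\<^sub>R g (Complex (- ?r (sin \<theta>)) (sin \<theta>)) = g (cis \<theta>) * cos \<theta>"
        by (simp add: cos_squared_eq[symmetric] cis.code)
    qed
    finally show ?thesis .
  qed
  also have "integral {-(pi/2)..pi/2} (\<lambda>\<theta>. g (cis \<theta>) * cos \<theta>) - - integral {pi/2..3*pi/2} (\<lambda>\<theta>. g (cis \<theta>) * cos \<theta>)
      = integral {-(pi/2)..2*pi - pi/2} (\<lambda>\<theta>. g (cis \<theta>) * cos \<theta>)"
  proof -
    have "integral {-(pi/2)..pi/2} (\<lambda>\<theta>. g (cis \<theta>) * cos \<theta>) + integral {pi/2..3*pi/2} (\<lambda>\<theta>. g (cis \<theta>) * cos \<theta>)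
      = integral {-(pi/2)..3*pi/2} (\<lambda>\<theta>. g (cis \<theta>) * cos \<theta>)"
      by (rule Henstock_Kurzweil_Integration.integral_combine) (auto intro!: integrable_continuous_real cg)
    moreover have "2*pi - pi/2 = 3*pi/2" by simp
    ultimately show ?thesis by simp
  qed
  also have "\<dots> = integral {0..2*pi} (\<lambda>\<theta>. g (cis \<theta>) * cos \<theta>)"
    by (rule integral_periodic_shift[OF cg]) (auto simp: cis.code)
  finally show ?thesis .
qed

text \<open>
  The same for vertical chords, with \<open>x = cos \<theta>\<close> on the upper and on the lower half of the circle.
\<close>
lemma green_disc_Im:
  fixes g h :: "complex \<Rightarrow> real"
  assumes g: "continuous_on (cball 0 1) g" and h: "continuous_on (cball 0 1) h"
    and der: "\<And>x y. Complex x y \<in> cball 0 1 \<Longrightarrow> ((\<lambda>y. g (Complex x y)) has_real_derivative h (Complex x y)) (at y)"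
  shows "integral (cball 0 1) h = integral {0..2*pi} (\<lambda>\<theta>. g (cis \<theta>) * sin \<theta>)"
proof -
  let ?r = "\<lambda>y::real. sqrt (1 - y\<^sup>2)"
  have r: "Complex y (?r y) \<in> cball 0 1" "Complex y (- ?r y) \<in> cball 0 1" if "y \<in> {-1..1}" for y
    using that by (auto simp: cmod_def abs_square_le_1 abs_le_iff)
  have c1: "continuous_on {-1..1} (\<lambda>y. g (Complex y (?r y)))"
    by (rule continuous_on_compose2[OF g]) (use r in \<open>auto intro!: continuous_intros simp: Complex_eq\<close>)
  have c2: "continuous_on {-1..1} (\<lambda>y. g (Complex y (- ?r y)))"
    by (rule continuous_on_compose2[OF g]) (use r in \<open>auto intro!: continuous_intros simp: Complex_eq\<close>)
  have cg: "continuous_on A (\<lambda>\<theta>. g (cis \<theta>) * sin \<theta>)" for A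
    by (intro continuous_on_mult continuous_on_compose2[OF g]) (auto intro!: continuous_intros)
  have "integral (cball 0 1) h
      = integral {-1..1} (\<lambda>y. g (Complex y (?r y))) - integral {-1..1} (\<lambda>y. g (Complex y (- ?r y)))"
    by (rule integral_disc_directional_derivative[where T = "\<lambda>x y. Complex y x",
          OF integral_complex_iterated(2) _ _ g h der])
       (auto simp: Complex_eq split_beta cmod_power2 intro!: continuous_intros)
  also have "integral {-1..1} (\<lambda>y. g (Complex y (?r y))) = integral {0..pi} (\<lambda>\<theta>. g (cis \<theta>) * sin \<theta>)"
  proof -
    have "((\<lambda>\<theta>. - sin \<theta> *\<^sub>R g (Complex (cos \<theta>) (?r (cos \<theta>)))) has_integral
        (integral {cos 0..cos pi} (\<lambda>y. g (Complex y (?r y))) -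
         integral {cos pi..cos 0} (\<lambda>y. g (Complex y (?r y))))) {0..pi}"
      by (rule has_integral_substitution_general[where c="-1" and d=1 and s="{}"])
         (auto intro!: c1 derivative_eq_intros continuous_intros)
    from integral_unique[OF this] have "integral {-1..1} (\<lambda>y. g (Complex y (?r y)))
        = integral {0..pi} (\<lambda>\<theta>. sin \<theta> *\<^sub>R g (Complex (cos \<theta>) (?r (cos \<theta>))))"
      by simp
    also have "\<dots> = integral {0..pi} (\<lambda>\<theta>. g (cis \<theta>) * sin \<theta>)"
      by (rule integral_cong) (auto simp: sin_squared_eq[symmetric] sin_ge_zero cis.code)
    finally show ?thesis .
  qed
  also have "integral {-1..1} (\<lambda>y. g (Complex y (- ?r y))) = - integral {pi..2*pi} (\<lambda>\<theta>. g (cis \<theta>) * sin \<theta>)"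
  proof -
    have "((\<lambda>\<theta>. - sin \<theta> *\<^sub>R g (Complex (cos \<theta>) (- ?r (cos \<theta>)))) has_integral
        (integral {cos pi..cos (2*pi)} (\<lambda>y. g (Complex y (- ?r y))))) {pi..2*pi}"
      by (rule has_integral_substitution[where c="-1" and d=1])
         (auto intro!: c2 derivative_eq_intros continuous_intros)
    from integral_unique[OF this] have "integral {-1..1} (\<lambda>y. g (Complex y (- ?r y)))
        = integral {pi..2*pi} (\<lambda>\<theta>. - sin \<theta> *\<^sub>R g (Complex (cos \<theta>) (- ?r (cos \<theta>))))"
      by simp
    also have "\<dots> = integral {pi..2*pi} (\<lambda>\<theta>. - (g (cis \<theta>) * sin \<theta>))"
    proof (rule integral_cong)
      fix \<theta> assume "\<theta> \<in> {pi..2*pi}"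
      then have "sin (\<theta> - pi) \<ge> 0" by (intro sin_ge_zero) auto
      then have "sin \<theta> \<le> 0" by (simp add: sin_diff)
      then show "- sin \<theta> *\<^sub>R g (Complex (cos \<theta>) (- ?r (cos \<theta>))) = - (g (cis \<theta>) * sin \<theta>)"
        by (simp add: sin_squared_eq[symmetric] cis.code)
    qed
    finally show ?thesis by simp
  qed
  also have "integral {0..pi} (\<lambda>\<theta>. g (cis \<theta>) * sin \<theta>) - - integral {pi..2*pi} (\<lambda>\<theta>. g (cis \<theta>) * sin \<theta>)
      = integral {0..2*pi} (\<lambda>\<theta>. g (cis \<theta>) * sin \<theta>)"
    using Henstock_Kurzweil_Integration.integral_combine[of 0 pi "2*pi" "\<lambda>\<theta>. g (cis \<theta>) * sin \<theta>"]
    by (simp add: integrable_continuous_real cg)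
  finally show ?thesis .
qed

lemma std_symplectic_inner: "std_symplectic v w = v \<bullet> (- \<i> * fst w, - \<i> * snd w)"
  by (simp add: std_symplectic_def inner_prod_def inner_complex_def algebra_simps)

lemma bounded_bilinear_std_symplectic: "bounded_bilinear std_symplectic"
proof -
  have "bounded_linear (\<lambda>w::complex \<times> complex. (- \<i> * fst w, - \<i> * snd w))"
    by (intro bounded_linear_Pair bounded_linear_mult_right[THEN bounded_linear_compose]
        bounded_linear_fst bounded_linear_snd)
  from bounded_bilinear.comp[OF bounded_bilinear_inner bounded_linear_ident this]
  show ?thesis unfolding std_symplectic_inner[symmetric] .
qed

interpretation std_symplectic: bounded_bilinear std_symplectic
  by (rule bounded_bilinear_std_symplectic)

lemma std_symplectic_skew: "std_symplectic v w = - std_symplectic w v"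
  by (simp add: std_symplectic_def)

text \<open>
  The radial primitive of the standard symplectic form, \<open>\<Sum>\<^sub>j (x\<^sub>j dy\<^sub>j - y\<^sub>j dx\<^sub>j) / 2\<close>.
\<close>
definition liouville :: "complex \<times> complex \<Rightarrow> complex \<times> complex \<Rightarrow> real" where
  "liouville z v = std_symplectic z v / 2"

lemma has_derivative_along_axes:
  fixes g :: "complex \<Rightarrow> real"
  assumes "(g has_derivative g') (at (Complex x y))"
  shows "((\<lambda>x. g (Complex x y)) has_real_derivative g' 1) (at x)"
    and "((\<lambda>y. g (Complex x y)) has_real_derivative g' \<i>) (at y)"
proof -
  interpret linear g' using has_derivative_linear[OF assms] .
  have "((\<lambda>x. Complex x y) has_derivative (\<lambda>h. h *\<^sub>R 1)) (at x)"
    unfolding Complex_eq by (auto intro!: derivative_eq_intros simp: of_real_def)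
  from has_derivative_compose[OF this assms]
  show "((\<lambda>x. g (Complex x y)) has_real_derivative g' 1) (at x)"
    unfolding has_field_derivative_def scale by (simp add: mult_commute_abs)
  have "((\<lambda>y. Complex x y) has_derivative (\<lambda>h. h *\<^sub>R \<i>)) (at y)"
    unfolding Complex_eq by (auto intro!: derivative_eq_intros simp: scaleR_conv_of_real mult.commute)
  from has_derivative_compose[OF this assms]
  show "((\<lambda>y. g (Complex x y)) has_real_derivative g' \<i>) (at y)"
    unfolding has_field_derivative_def scale by (simp add: mult_commute_abs)
qed

lemma smooth_onD:
  assumes "smooth_on U u"
  shows "x \<in> U \<Longrightarrow> (u has_derivative frechet_derivative u (at x)) (at x)"
    and "x \<in> U \<Longrightarrow> ((\<lambda>x. frechet_derivative u (at x) v) has_derivative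
           frechet_derivative (\<lambda>x. frechet_derivative u (at x) v) (at x)) (at x)"
    and "continuous_on U u"
    and "continuous_on U (\<lambda>x. frechet_derivative u (at x) v)"
    and "continuous_on U (\<lambda>x. frechet_derivative (\<lambda>x. frechet_derivative u (at x) v) (at x) w)"
proof -
  have c: "Ck_on 0 U u" "Ck_on (Suc 0) U u" "Ck_on (Suc (Suc 0)) U u"
    using assms by (auto simp only: smooth_on_def)
  show "x \<in> U \<Longrightarrow> (u has_derivative frechet_derivative u (at x)) (at x)"
   "x \<in> U \<Longrightarrow> ((\<lambda>x. frechet_derivative u (at x) v) has_derivative
           frechet_derivative (\<lambda>x. frechet_derivative u (at x) v) (at x)) (at x)"
    using c(3) by (auto simp: frechet_derivative_works[symmetric])
  show "continuous_on U u"
    "continuous_on U (\<lambda>x. frechet_derivative u (at x) v)"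
    "continuous_on U (\<lambda>x. frechet_derivative (\<lambda>x. frechet_derivative u (at x) v) (at x) w)"
    using c by auto
qed

text \<open>
  With \<open>P dx + Q dy\<close> the pullback of the Liouville form, \<open>Q\<^sub>x - P\<^sub>y\<close> is the pullback of the symplectic form:
  the terms with second derivatives of \<open>u\<close> cancel because these commute. Green's theorem does the rest.
\<close>
lemma stokes_disc:
  assumes "smooth_disc u"
  shows "symplectic_area u
       = integral {0..2*pi} (\<lambda>\<theta>. liouville (u (cis \<theta>)) (frechet_derivative u (at (cis \<theta>)) (\<i> * cis \<theta>)))"
proof -
  let ?D = "cball 0 1 :: complex set"
  obtain U where U: "open U" "?D \<subseteq> U" "smooth_on U u"
    using assms unfolding smooth_disc_def by blast
  let ?d = "\<lambda>v x. frechet_derivative u (at x) v"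
  let ?dd = "\<lambda>v x. frechet_derivative (?d v) (at x)"
  note u = smooth_onD[OF U(3)]
  have comm: "?dd 1 x \<i> = ?dd \<i> x 1" if x: "x \<in> U" for x
  proof -
    have "?dd 1 x \<i> \<bullet> b = ?dd \<i> x 1 \<bullet> b" for b
    proof (rule mixed_derivatives_commute[OF U(1) x, where f = "\<lambda>x. u x \<bullet> b" and f' = "\<lambda>x v. ?d v x \<bullet> b"
          and fv = "\<lambda>x v. ?dd 1 x v \<bullet> b" and fw = "\<lambda>x v. ?dd \<i> x v \<bullet> b"])
      have "continuous_on U (\<lambda>x. ?dd v x w \<bullet> b)" for v w
        by (intro continuous_intros u(5))
      then show "isCont (\<lambda>x. ?dd 1 x \<i> \<bullet> b) x" "isCont (\<lambda>x. ?dd \<i> x 1 \<bullet> b) x"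
        using continuous_on_eq_continuous_at[OF U(1)] x by blast+
    qed (auto intro!: has_derivative_inner_left u)
    then show ?thesis by (meson vector_eq_rdot)
  qed
  let ?Q = "\<lambda>z. liouville (u z) (?d \<i> z)" and ?P = "\<lambda>z. liouville (u z) (?d 1 z)"
  let ?Qx = "\<lambda>z. (std_symplectic (u z) (?dd \<i> z 1) + std_symplectic (?d 1 z) (?d \<i> z)) / 2"
  let ?Py = "\<lambda>z. (std_symplectic (u z) (?dd 1 z \<i>) + std_symplectic (?d \<i> z) (?d 1 z)) / 2"
  have cont: "continuous_on ?D ?Q" "continuous_on ?D ?P" "continuous_on ?D ?Qx" "continuous_on ?D ?Py"
    unfolding liouville_def
    by (intro continuous_intros std_symplectic.continuous_on continuous_on_subset[OF u(3) U(2)]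
        continuous_on_subset[OF u(4) U(2)] continuous_on_subset[OF u(5) U(2)]; simp)+
  have der: "((\<lambda>z. liouville (u z) (?d v z)) has_derivative
      (\<lambda>h. (std_symplectic (u z) (?dd v z h) + std_symplectic (?d h z) (?d v z)) / 2)) (at z)"
    if "z \<in> U" for v z
    using bounded_linear.has_derivative[OF bounded_linear_divide[of 2]
        std_symplectic.FDERIV[OF u(1)[OF that] u(2)[OF that, of v]]]
    by (simp add: liouville_def)
  have derx: "((\<lambda>x. ?Q (Complex x y)) has_real_derivative ?Qx (Complex x y)) (at x)"
    if "Complex x y \<in> ?D" for x y
    using has_derivative_along_axes(1)[OF der[of "Complex x y" \<i>]] that U(2) by auto
  have dery: "((\<lambda>y. ?P (Complex x y)) has_real_derivative ?Py (Complex x y)) (at y)"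
    if "Complex x y \<in> ?D" for x y
    using has_derivative_along_axes(2)[OF der[of "Complex x y" 1]] that U(2) by auto
  have "symplectic_area u = integral ?D (\<lambda>z. ?Qx z - ?Py z)"
    unfolding symplectic_area_def
  proof (rule integral_cong)
    fix z assume "z \<in> ?D"
    then show "std_symplectic (?d 1 z) (?d \<i> z) = ?Qx z - ?Py z"
      using comm[of z] U(2) std_symplectic_skew[of "?d \<i> z" "?d 1 z"]
      by (auto simp: subset_iff field_simps)
  qed
  also have "\<dots> = integral ?D ?Qx - integral ?D ?Py"
  proof (rule integral_diff)
    have "F integrable_on ?D" if "continuous_on ?D F" for F :: "complex \<Rightarrow> real"
      by (rule set_borel_integral_eq_integral(1), unfold set_integrable_def,
          rule borel_integrable_compact) (auto intro: that)
    then show "?Qx integrable_on ?D" "?Py integrable_on ?D" using cont by blast+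
  qed
  also have "\<dots> = integral {0..2*pi} (\<lambda>\<theta>. ?Q (cis \<theta>) * cos \<theta>) - integral {0..2*pi} (\<lambda>\<theta>. ?P (cis \<theta>) * sin \<theta>)"
    using green_disc_Re[OF cont(1,3) derx] green_disc_Im[OF cont(2,4) dery] by simp
  also have "\<dots> = integral {0..2*pi} (\<lambda>\<theta>. ?Q (cis \<theta>) * cos \<theta> - ?P (cis \<theta>) * sin \<theta>)"
    by (rule integral_diff[symmetric])
       (auto intro!: integrable_continuous_real continuous_intros continuous_on_compose2[OF cont(1)]
          continuous_on_compose2[OF cont(2)])
  also have "\<dots> = integral {0..2*pi} (\<lambda>\<theta>. liouville (u (cis \<theta>)) (?d (\<i> * cis \<theta>) (cis \<theta>)))"
  proof (rule integral_cong)
    fix \<theta> :: real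
    have "cis \<theta> \<in> U" using U(2) by auto
    from has_derivative_linear[OF u(1)[OF this]] interpret linear "\<lambda>v. ?d v (cis \<theta>)" .
    have e: "\<i> * cis \<theta> = cos \<theta> *\<^sub>R \<i> + (- sin \<theta>) *\<^sub>R 1" by (simp add: complex_eq_iff)
    have "?d (\<i> * cis \<theta>) (cis \<theta>) = cos \<theta> *\<^sub>R ?d \<i> (cis \<theta>) + (- sin \<theta>) *\<^sub>R ?d 1 (cis \<theta>)"
      unfolding e add scale ..
    then have "std_symplectic (u (cis \<theta>)) (?d (\<i> * cis \<theta>) (cis \<theta>))
        = cos \<theta> * std_symplectic (u (cis \<theta>)) (?d \<i> (cis \<theta>))
          - sin \<theta> * std_symplectic (u (cis \<theta>)) (?d 1 (cis \<theta>))"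
      by (simp add: std_symplectic.diff_right std_symplectic.scaleR_right)
    then show "?Q (cis \<theta>) * cos \<theta> - ?P (cis \<theta>) * sin \<theta> = liouville (u (cis \<theta>)) (?d (\<i> * cis \<theta>) (cis \<theta>))"
      by (simp add: liouville_def field_simps)
  qed
  finally show ?thesis .
qed

section \<open>Symplectic area of discs with boundary on a torus\<close>

text \<open>
  Used for \<open>exp (2 \<pi> \<i> g)\<close>, where \<open>g\<close> is a primitive with integer periods.
\<close>
lemma integer_lattice_periodic:
  fixes H :: "real \<times> real \<Rightarrow> 'a"
  assumes "\<And>p. H (p + (1, 0)) = H p" "\<And>p. H (p + (0, 1)) = H p"
    and "fst p - fst q \<in> \<int>" "snd p - snd q \<in> \<int>"
  shows "H p = H q"
proof -
  have shift: "H (p + of_int n *\<^sub>R e) = H p" if e: "\<And>p. H (p + e) = H p" for e p and n :: int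
  proof -
    have nat: "H (p + of_nat k *\<^sub>R e) = H p" for k p
    proof (induction k)
      case (Suc k)
      have "p + of_nat (Suc k) *\<^sub>R e = (p + of_nat k *\<^sub>R e) + e" by (simp add: algebra_simps)
      then show ?case using e Suc by metis
    qed simp
    show ?thesis
    proof (cases n)
      case (nonneg k)
      then show ?thesis using nat by simp
    next
      case (neg k)
      then have "p + of_int n *\<^sub>R e + of_nat (Suc k) *\<^sub>R e = p" by (simp flip: scaleR_add_left)
      then show ?thesis using nat by metis
    qed
  qed
  obtain m n where "fst p - fst q = of_int m" "snd p - snd q = of_int n"
    using assms(3,4) by (auto elim!: Ints_cases)
  then have "p = q + of_int m *\<^sub>R (1, 0) + of_int n *\<^sub>R (0, 1)"
    by (auto simp: prod_eq_iff)
  then show ?thesis using shift assms(1,2) by metis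
qed

lemma injective_derivative_lower_bound:
  fixes f :: "'a::euclidean_space \<Rightarrow> 'b::euclidean_space"
  assumes f: "(f has_derivative f') (at x)" and "inj f'"
  shows "\<exists>c>0. \<forall>\<^sub>F y in nhds x. c * norm (y - x) \<le> norm (f y - f x)"
proof -
  obtain c where c: "c > 0" "\<And>v. c * norm v \<le> norm (f' v)"
    using linear_inj_bounded_below_pos[OF has_derivative_linear[OF f] \<open>inj f'\<close>] by (metis mult.commute)
  have "c / 2 > 0" using c by simp
  then obtain d where d: "d > 0"
      "\<And>y. norm (y - x) < d \<Longrightarrow> norm (f y - f x - f' (y - x)) \<le> c / 2 * norm (y - x)"
    using f unfolding has_derivative_at_alt by blast
  have "c / 2 * norm (y - x) \<le> norm (f y - f x)" if "dist y x < d" for y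
  proof -
    have "norm (f' (y - x)) \<le> norm (f y - f x) + norm (f y - f x - f' (y - x))"
      by (metis add_diff_cancel_left' diff_add_cancel norm_minus_commute norm_triangle_sub)
    then show ?thesis using d(2)[of y] c(2)[of "y - x"] that by (simp add: dist_norm)
  qed
  then have "\<forall>\<^sub>F y in nhds x. c / 2 * norm (y - x) \<le> norm (f y - f x)"
    using d(1) unfolding eventually_nhds_metric by blast
  then show ?thesis using \<open>c / 2 > 0\<close> by blast
qed

lemma has_derivative_upper_bound:
  assumes f: "(f has_derivative f') (at x)"
  shows "\<exists>C>0. \<forall>\<^sub>F y in nhds x. norm (f y - f x) \<le> C * norm (y - x)"
proof -
  interpret bounded_linear f' using has_derivative_bounded_linear[OF f] .
  obtain K where K: "K > 0" "\<And>v. norm (f' v) \<le> norm v * K" using pos_bounded by blast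
  obtain d where d: "d > 0"
      "\<And>y. norm (y - x) < d \<Longrightarrow> norm (f y - f x - f' (y - x)) \<le> 1 * norm (y - x)"
    using f unfolding has_derivative_at_alt by (metis zero_less_one)
  have "norm (f y - f x) \<le> (K + 1) * norm (y - x)" if "dist y x < d" for y
  proof -
    have "norm (f y - f x) \<le> norm (f' (y - x)) + norm (f y - f x - f' (y - x))"
      by (metis norm_triangle_sub add.commute)
    then show ?thesis using d(2)[of y] K(2)[of "y - x"] that by (simp add: dist_norm algebra_simps)
  qed
  then have "\<forall>\<^sub>F y in nhds x. norm (f y - f x) \<le> (K + 1) * norm (y - x)"
    using d(1) unfolding eventually_nhds_metric by blast
  then show ?thesis using K(1) by (intro exI[of _ "K + 1"]) auto
qed

lemma torus_embeddingD:
  assumes "torus_embedding f"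
  shows "(f has_derivative frechet_derivative f (at x)) (at x)" "isCont f x"
    "inj (frechet_derivative f (at x))"
    "f x = f y \<longleftrightarrow> fst x - fst y \<in> \<int> \<and> snd x - snd y \<in> \<int>"
proof -
  have s: "smooth_on UNIV f" using assms by (simp add: torus_embedding_def)
  show "(f has_derivative frechet_derivative f (at x)) (at x)" using smooth_onD(1)[OF s] by simp
  then show "isCont f x" by (rule has_derivative_continuous)
qed (use assms in \<open>simp_all add: torus_embedding_def del: split_paired_All\<close>)

text \<open>
  A loop in the torus need only be lifted to the plane near one parameter value. Choose for every point of
  the loop the preimage in the unit square centred at a given preimage of \<open>v t\<close>. This choice is
  continuous at \<open>t\<close> by compactness: outside a neighbourhood of the centre, the closed square contains no
  preimage of \<open>v t\<close>, hence none of nearby points.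
\<close>
lemma torus_embedding_local_lift:
  fixes v :: "real \<Rightarrow> complex \<times> complex"
  assumes f: "torus_embedding f" and v: "isCont v t" "\<And>s. v s \<in> range f"
  obtains p where "\<And>s. f (p s) = v s" "isCont p t"
proof -
  obtain p0 where p0: "f p0 = v t" using v(2)[of t] by auto
  \<comment> \<open>a closed fundamental domain centred at \<open>p0\<close>\<close>
  define K where "K = cbox (p0 - (1/2, 1/2)) (p0 + (1/2, 1/2))"
  have K: "q \<in> K \<longleftrightarrow> \<bar>fst q - fst p0\<bar> \<le> 1/2 \<and> \<bar>snd q - snd p0\<bar> \<le> 1/2" for q
  proof -
    have "K = {fst p0 - 1/2..fst p0 + 1/2} \<times> {snd p0 - 1/2..snd p0 + 1/2}"
      by (cases p0) (simp add: K_def cbox_Pair_eq)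
    then show ?thesis by (simp only: mem_Times_iff atLeastAtMost_iff abs_diff_le_iff)
  qed
  have ex: "\<exists>q\<in>K. f q = v s" for s
  proof -
    obtain q where q: "f q = v s" using v(2)[of s] by auto
    \<comment> \<open>translate into the unit square around \<open>p0\<close>\<close>
    define q' where "q' = (fst q - of_int (round (fst q - fst p0)), snd q - of_int (round (snd q - snd p0)))"
    have "q' \<in> K"
      unfolding K q'_def using of_int_round_abs_le[of "fst q - fst p0"] of_int_round_abs_le[of "snd q - snd p0"]
      by (simp add: abs_minus_commute algebra_simps)
    moreover have "f q' = f q" unfolding torus_embeddingD(4)[OF f] by (simp add: q'_def)
    ultimately show ?thesis using q by auto
  qed
  have uniq: "q = p0" if "q \<in> K" "f q = v t" for q
  proof -
    have int: "fst q - fst p0 \<in> \<int>" "snd q - snd p0 \<in> \<int>"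
      using that(2) p0 torus_embeddingD(4)[OF f, of q p0] by auto
    have "x = 0" if "x \<in> \<int>" "\<bar>x\<bar> \<le> 1/2" for x :: real
      using that by (auto elim!: Ints_cases)
    from this[OF int(1)] this[OF int(2)] show ?thesis using that(1) by (auto simp: K prod_eq_iff)
  qed
  obtain p where p: "\<And>s. p s \<in> K" "\<And>s. f (p s) = v s" using ex by metis
  have pt: "p t = p0" using uniq p by blast
  have "isCont p t"
    unfolding isCont_def
  proof (rule topological_tendstoI)
    fix V assume V: "open V" "p t \<in> V"
    have "compact (K - V)" unfolding K_def using V by (intro compact_diff) auto
    then have "compact (f ` (K - V))"
      by (rule compact_continuous_image[rotated])
         (auto intro!: continuous_at_imp_continuous_on torus_embeddingD(2)[OF f])
    then have "open (- f ` (K - V))" using compact_imp_closed by blast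
    moreover have "v t \<in> - f ` (K - V)" using uniq V(2) pt by auto
    ultimately have "\<forall>\<^sub>F s in at t. v s \<in> - f ` (K - V)"
      using v(1) unfolding isCont_def by (rule topological_tendstoD[rotated])
    then show "\<forall>\<^sub>F s in at t. p s \<in> V"
      by eventually_elim (use p in \<open>metis ComplD DiffI imageI\<close>)
  qed
  with p show ?thesis using that by blast
qed

text \<open>
  No smoothness of the lift is known, but none is needed. The function \<open>k = g - \<lambda> \<circ> f\<close>, where \<open>\<lambda>\<close> is the
  Liouville form frozen at \<open>v t\<close>, has derivative 0 at \<open>p t\<close>. Since \<open>f\<close> is an immersion, the lift satisfies
  a Lipschitz estimate at \<open>t\<close>, so \<open>k \<circ> p\<close> has derivative 0 too, and the derivative of \<open>g \<circ> p\<close> is that of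
  \<open>\<lambda> \<circ> v\<close>.
\<close>
lemma primitive_along_lift:
  fixes v :: "real \<Rightarrow> complex \<times> complex"
  assumes f: "torus_embedding f"
    and g: "\<And>p. (g has_derivative (\<lambda>w. liouville (f p) (frechet_derivative f (at p) w))) (at p)"
    and v: "(v has_vector_derivative v') (at t)"
    and p: "\<And>s. f (p s) = v s" "isCont p t"
  shows "((\<lambda>s. g (p s)) has_real_derivative liouville (v t) v') (at t)"
proof -
  interpret L: bounded_linear "liouville (v t)"
    unfolding liouville_def
    by (intro bounded_linear_compose[OF bounded_linear_divide] std_symplectic.bounded_linear_right)
  define k where "k q = g q - liouville (v t) (f q)" for q
  have k0: "(k has_derivative (\<lambda>_. 0)) (at (p t))"
    unfolding k_def[abs_def]
    by (rule has_derivative_eq_rhs[OF has_derivative_diff[OF g[of "p t"]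
          L.has_derivative[OF torus_embeddingD(1)[OF f, of "p t"]]]]) (simp add: p(1))
  have vd: "(v has_derivative (\<lambda>h. h *\<^sub>R v')) (at t)" using v by (simp add: has_vector_derivative_def)
  obtain c where c: "c > 0" "\<forall>\<^sub>F q in nhds (p t). c * norm (q - p t) \<le> norm (f q - f (p t))"
    using injective_derivative_lower_bound[OF torus_embeddingD(1)[OF f] torus_embeddingD(3)[OF f]] by blast
  obtain C where C: "C > 0" "\<forall>\<^sub>F s in nhds t. norm (v s - v t) \<le> C * norm (s - t)"
    using has_derivative_upper_bound[OF vd] by blast
  have pl: "filterlim p (nhds (p t)) (nhds t)"
    using p(2) by (simp add: isCont_def tendsto_at_iff_tendsto_nhds)
  have lip: "\<forall>\<^sub>F s in nhds t. norm (p s - p t) \<le> C / c * norm (s - t)"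
    using eventually_compose_filterlim[OF c(2) pl] C(2)
  proof eventually_elim
    case (elim s)
    then have "c * norm (p s - p t) \<le> C * norm (s - t)" using p(1) by simp
    then show ?case using c(1) by (simp add: field_simps)
  qed
  have "((\<lambda>s. k (p s)) has_derivative (\<lambda>_. 0)) (at t)"
    unfolding has_derivative_at_alt
  proof (intro conjI allI impI)
    fix e :: real assume e: "e > 0"
    define e' where "e' = e * c / C"
    have e': "e' > 0" using e c C by (simp add: e'_def)
    then obtain d where "d > 0" "\<And>q. norm (q - p t) < d \<Longrightarrow> norm (k q - k (p t)) \<le> e' * norm (q - p t)"
      using k0 unfolding has_derivative_at_alt by auto
    then have "\<forall>\<^sub>F q in nhds (p t). norm (k q - k (p t)) \<le> e' * norm (q - p t)"
      unfolding eventually_nhds_metric dist_norm by blast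
    from eventually_compose_filterlim[OF this pl] lip
    have "\<forall>\<^sub>F s in nhds t. norm (k (p s) - k (p t)) \<le> e * norm (s - t)"
    proof eventually_elim
      case (elim s)
      have "norm (k (p s) - k (p t)) \<le> e' * (C / c * norm (s - t))"
        using elim e' by (meson mult_left_mono order_trans less_imp_le)
      also have "\<dots> = e * norm (s - t)" using c(1) C(1) by (simp add: e'_def)
      finally show ?case .
    qed
    then show "\<exists>d>0. \<forall>y. norm (y - t) < d \<longrightarrow> norm (k (p y) - k (p t) - 0) \<le> e * norm (y - t)"
      unfolding eventually_nhds_metric dist_norm by simp
  qed simp
  from has_derivative_add[OF this L.has_derivative[OF vd]]
  have "((\<lambda>s. g (p s)) has_derivative (\<lambda>h. liouville (v t) (h *\<^sub>R v'))) (at t)"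
    by (simp add: k_def p(1))
  then show ?thesis
    unfolding has_field_derivative_def L.scaleR by (simp add: mult_commute_abs)
qed

text \<open>
  The function \<open>exp (2 \<pi> \<i> g)\<close> descends to the torus because \<open>g\<close> has integer periods. Along the
  boundary of the disc, its argument changes at the rate of \<open>2 \<pi>\<close> times the Liouville form. Going around
  once it returns to its initial value, so the integral of the form over the boundary is an integer.
\<close>
lemma symplectic_area_integer:
  assumes f: "torus_embedding f"
    and g: "\<And>p. (g has_derivative (\<lambda>w. liouville (f p) (frechet_derivative f (at p) w))) (at p)"
    and per: "\<And>p. g (p + (1, 0)) - g p \<in> \<int>" "\<And>p. g (p + (0, 1)) - g p \<in> \<int>"
    and u: "smooth_disc u" "u ` sphere 0 1 \<subseteq> range f"
  shows "symplectic_area u \<in> \<int>"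
proof -
  have cis_int: "cis (2*pi*x) = 1 \<longleftrightarrow> x \<in> \<int>" for x
    by (auto simp: cis_conv_exp exp_eq_1 Ints_def)
  have hol: "cis (2 * pi * g p) = cis (2 * pi * g q)" if "f p = f q" for p q
  proof (rule integer_lattice_periodic[where H = "\<lambda>p. cis (2 * pi * g p)"])
    have "cis (2 * pi * x) = cis (2 * pi * y)" if "x - y \<in> \<int>" for x y
    proof -
      have "cis (2 * pi * x) = cis (2 * pi * (x - y)) * cis (2 * pi * y)"
        by (simp add: cis_mult algebra_simps)
      then show ?thesis using that cis_int by simp
    qed
    with per show "\<And>p. cis (2 * pi * g (p + (1, 0))) = cis (2 * pi * g p)"
      "\<And>p. cis (2 * pi * g (p + (0, 1))) = cis (2 * pi * g p)" by blast+
  qed (use that torus_embeddingD(4)[OF f] in auto)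
  define v where "v \<theta> = u (cis \<theta>)" for \<theta>
  define v' where "v' \<theta> = frechet_derivative u (at (cis \<theta>)) (\<i> * cis \<theta>)" for \<theta>
  define j where "j \<theta> = integral {0..\<theta>} (\<lambda>\<theta>. liouville (v \<theta>) (v' \<theta>))" for \<theta>
  define \<Phi> where "\<Phi> z = cis (2 * pi * g (SOME p. f p = z))" for z
  have \<Phi>: "\<Phi> (f p) = cis (2 * pi * g p)" for p
    unfolding \<Phi>_def by (rule hol, rule someI, rule refl)
  obtain U where U: "open U" "cball 0 1 \<subseteq> U" "smooth_on U u"
    using u(1) unfolding smooth_disc_def by blast
  have cisU: "cis \<theta> \<in> U" for \<theta> using U(2) by auto
  have vr: "v \<theta> \<in> range f" for \<theta> using u(2) by (auto simp: v_def)
  have vd: "(v has_vector_derivative v' \<theta>) (at \<theta>)" for \<theta>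
  proof -
    note D = smooth_onD(1)[OF U(3) cisU[of \<theta>]]
    have "(cis has_derivative (\<lambda>h. h *\<^sub>R (\<i> * cis \<theta>))) (at \<theta>)"
      by (auto intro!: derivative_eq_intros)
    from has_derivative_compose[OF this D] show ?thesis
      unfolding v_def v'_def has_vector_derivative_def linear_scale[OF has_derivative_linear[OF D]] .
  qed
  have cont: "continuous_on A (\<lambda>\<theta>. liouville (v \<theta>) (v' \<theta>))" for A
  proof -
    have "v' \<theta> = cos \<theta> *\<^sub>R frechet_derivative u (at (cis \<theta>)) \<i> - sin \<theta> *\<^sub>R frechet_derivative u (at (cis \<theta>)) 1" for \<theta>
    proof -
      note lin = has_derivative_linear[OF smooth_onD(1)[OF U(3) cisU[of \<theta>]]]
      have "\<i> * cis \<theta> = cos \<theta> *\<^sub>R \<i> - sin \<theta> *\<^sub>R 1" by (simp add: complex_eq_iff)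
      then show ?thesis by (simp add: v'_def linear_diff[OF lin] linear_scale[OF lin])
    qed
    then show ?thesis
      unfolding liouville_def v_def
      by (auto intro!: continuous_intros std_symplectic.continuous_on continuous_on_compose2[OF smooth_onD(3)[OF U(3)]]
          continuous_on_compose2[OF smooth_onD(4)[OF U(3)]] simp: cisU)
  qed
  define E where "E \<theta> = \<Phi> (v \<theta>) * cis (- 2 * pi * j \<theta>)" for \<theta>
  have "(E has_derivative (\<lambda>_. 0)) (at \<theta> within {0..2*pi})" if \<theta>: "\<theta> \<in> {0..2*pi}" for \<theta>
  proof -
    obtain p where p: "\<And>s. f (p s) = v s" "isCont p \<theta>"
      using torus_embedding_local_lift[OF f has_vector_derivative_continuous[OF vd] vr] by blast
    have "((\<lambda>s. g (p s)) has_real_derivative liouville (v \<theta>) (v' \<theta>)) (at \<theta> within {0..2*pi})"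
      using primitive_along_lift[OF f g vd p] by (rule has_field_derivative_at_within)
    moreover have "(j has_real_derivative liouville (v \<theta>) (v' \<theta>)) (at \<theta> within {0..2*pi})"
      unfolding j_def by (rule integral_has_real_derivative[OF cont \<theta>])
    ultimately have "((\<lambda>s. g (p s) - j s) has_real_derivative 0) (at \<theta> within {0..2*pi})"
      using DERIV_diff by fastforce
    then have "((\<lambda>s. g (p s) - j s) has_derivative (\<lambda>h. 0)) (at \<theta> within {0..2*pi})"
      by (simp add: has_field_derivative_def lambda_zero)
    moreover have "((\<lambda>s. cis (2 * pi * q s)) has_derivative (\<lambda>_. 0)) (at x within S)"
      if "(q has_derivative (\<lambda>_. 0)) (at x within S)" for q :: "real \<Rightarrow> real" and x S
      by (rule derivative_eq_intros that refl | simp)+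
    ultimately have "((\<lambda>s. cis (2 * pi * (g (p s) - j s))) has_derivative (\<lambda>_. 0)) (at \<theta> within {0..2*pi})"
      by blast
    moreover have "E = (\<lambda>s. cis (2 * pi * (g (p s) - j s)))"
      by (auto simp: E_def cis_mult algebra_simps \<Phi> simp flip: p(1))
    ultimately show ?thesis by simp
  qed
  then obtain c where c: "\<And>\<theta>. \<theta> \<in> {0..2*pi} \<Longrightarrow> E \<theta> = c"
    using has_derivative_zero_constant[of "{0..2*pi}" E] by (auto simp: convex_real_interval)
  have "\<Phi> (v 0) * cis (- 2 * pi * j 0) = \<Phi> (v (2*pi)) * cis (- 2 * pi * j (2*pi))"
    using c[of 0] c[of "2*pi"] by (simp add: E_def)
  moreover have "v (2*pi) = v 0" by (simp add: v_def)
  moreover have "j 0 = 0" by (simp add: j_def)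
  moreover have "\<Phi> z \<noteq> 0" for z by (simp add: \<Phi>_def)
  ultimately have "cis (2 * pi * (- j (2*pi))) = 1" by simp
  then have "j (2*pi) \<in> \<int>" unfolding cis_int by simp
  then show ?thesis
    using stokes_disc[OF u(1)] by (simp add: j_def v_def v'_def)
qed

section \<open>A curve of area one in a thin rectangle\<close>

text \<open>
  For small \<open>\<kappa>\<close> this is a smooth, strictly increasing approximation of the sign function. Applying it to both
  coordinates of the unit circle gives an embedded curve close to the boundary of the square \<open>[-1, 1]\<^sup>2\<close>.
\<close>
definition sigmoid :: "real \<Rightarrow> real \<Rightarrow> real" where
  "sigmoid \<kappa> u = u / sqrt (\<kappa>\<^sup>2 + u\<^sup>2)"

lemma sigmoid_denominator_pos: "\<kappa> > 0 \<Longrightarrow> 0 < \<kappa>\<^sup>2 + (u::real)\<^sup>2"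
  by (simp add: add_pos_nonneg)

lemma sigmoid_minus: "sigmoid \<kappa> (- u) = - sigmoid \<kappa> u"
  by (simp add: sigmoid_def)

lemma abs_sigmoid_less_1: "\<kappa> > 0 \<Longrightarrow> \<bar>sigmoid \<kappa> u\<bar> < 1"
proof -
  assume "\<kappa> > 0"
  then have "sqrt (u\<^sup>2) < sqrt (\<kappa>\<^sup>2 + u\<^sup>2)" by (subst real_sqrt_less_iff) simp
  then show ?thesis using sigmoid_denominator_pos[OF \<open>\<kappa> > 0\<close>, of u]
    by (simp add: sigmoid_def abs_divide)
qed

lemma sigmoid_has_derivative:
  assumes "\<kappa> > 0"
  shows "(sigmoid \<kappa> has_real_derivative \<kappa>\<^sup>2 / sqrt (\<kappa>\<^sup>2 + u\<^sup>2) ^ 3) (at u)"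
proof -
  let ?q = "sqrt (\<kappa>\<^sup>2 + u\<^sup>2)"
  note pos = sigmoid_denominator_pos[OF assms, of u]
  have q: "?q > 0" "?q * ?q = \<kappa>\<^sup>2 + u\<^sup>2" using pos by auto
  have "((\<lambda>u. \<kappa>\<^sup>2 + u\<^sup>2) has_real_derivative 2 * u) (at u)"
    by (auto intro!: derivative_eq_intros)
  note chain = DERIV_chain2[OF DERIV_real_sqrt[OF pos] this]
  have "((\<lambda>u. sqrt (\<kappa>\<^sup>2 + u\<^sup>2)) has_real_derivative u / ?q) (at u)"
    by (rule DERIV_cong[OF chain]) (simp add: field_simps)
  from DERIV_divide[OF DERIV_ident this less_imp_neq[OF q(1), symmetric]]
  have "(sigmoid \<kappa> has_real_derivative (1 * ?q - u * (u / ?q)) / (?q * ?q)) (at u)"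
    unfolding sigmoid_def[abs_def] .
  moreover have "(1 * ?q - u * (u / ?q)) / (?q * ?q) = (?q * ?q - u\<^sup>2) / ?q ^ 3"
    using q(1) by (simp add: divide_simps power2_eq_square power3_eq_cube)
  ultimately show ?thesis using q(2) by simp
qed

lemma sigmoid_strict_mono:
  assumes "\<kappa> > 0"
  shows "strict_mono (sigmoid \<kappa>)"
proof (rule strict_monoI)
  fix u v :: real assume "u < v"
  then show "sigmoid \<kappa> u < sigmoid \<kappa> v"
  proof (rule DERIV_pos_imp_increasing)
    fix x show "\<exists>y. DERIV (sigmoid \<kappa>) x :> y \<and> 0 < y"
      using sigmoid_denominator_pos[OF assms, of x] assms
      by (intro exI[of _ "\<kappa>\<^sup>2 / sqrt (\<kappa>\<^sup>2 + x\<^sup>2) ^ 3"] conjI sigmoid_has_derivative) simp_all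
  qed
qed

lemma elementary_sigmoid:
  assumes "\<kappa> > 0" "e \<in> elementary"
  shows "(\<lambda>p. sigmoid \<kappa> (e p)) \<in> elementary"
proof -
  have "e p * (\<kappa>\<^sup>2 + (e p)\<^sup>2) powr (- (1/2)) = sigmoid \<kappa> (e p)" for p
    by (simp add: sigmoid_def powr_minus_divide powr_half_sqrt)
  moreover have "(\<lambda>p. e p * (\<kappa>\<^sup>2 + (e p)\<^sup>2) powr (- (1/2))) \<in> elementary"
    by (intro elementary_intros sigmoid_denominator_pos assms)
  ultimately show ?thesis by simp
qed

lemma continuous_antiderivative_real:
  fixes f :: "real \<Rightarrow> real"
  assumes "continuous_on UNIV f"
  shows "\<exists>F. \<forall>x. (F has_real_derivative f x) (at x)"
proof -
  have "((\<lambda>u. LBINT y=ereal 0..u. f y) has_real_derivative f x) (at x)" for x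
  proof -
    have "((\<lambda>u. LBINT y=ereal 0..u. f y) has_vector_derivative f x) (at x within {- \<bar>x\<bar> - 1..\<bar>x\<bar> + 1})"
      by (rule interval_integral_FTC2) (simp_all add: continuous_on_subset[OF assms])
    moreover have "at x within {- \<bar>x\<bar> - 1..\<bar>x\<bar> + 1} = at x"
      by (rule at_within_interior) (auto simp: interior_atLeastAtMost_real abs_if)
    ultimately show ?thesis by (simp add: has_real_derivative_iff_has_vector_derivative)
  qed
  then show ?thesis by blast
qed

text \<open>
  \<open>G 1 - G 0\<close> is the area enclosed by the curve \<open>(sigmoid \<kappa> (cos 2\<pi>s), sigmoid \<kappa> (sin 2\<pi>s))\<close>. The area is at
  least that of the inscribed square with corners \<open>(\<plusminus>h, \<plusminus>h)\<close>, where \<open>h = sigmoid \<kappa> (cos (\<pi>/4))\<close>: the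
  integrand \<open>X Y'\<close> is nonnegative everywhere, at least \<open>h |Y'|\<close> on the right arc \<open>[-1/8, 1/8]\<close> and on the left
  arc \<open>[3/8, 5/8]\<close>, and \<open>Y\<close> changes by \<open>2 h\<close> along each of these arcs.
\<close>
lemma rounded_square_area:
  fixes G :: "real \<Rightarrow> real"
  assumes \<kappa>: "\<kappa> > 0" and Y: "\<And>s. (Y has_real_derivative Y' s) (at s)"
    and Y_def: "Y = (\<lambda>s. sigmoid \<kappa> (sin (2 * pi * s)))"
    and G: "\<And>s. (G has_real_derivative sigmoid \<kappa> (cos (2 * pi * s)) * Y' s) (at s)"
  shows "G (s + 1) - G s = G 1 - G 0" "G 1 - G 0 \<ge> 4 / (1 + 2 * \<kappa>\<^sup>2)"
proof -
  define h where "h = sigmoid \<kappa> (sqrt 2 / 2)"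
  have h2: "h * h = 1 / (1 + 2 * \<kappa>\<^sup>2)"
  proof -
    have pos: "\<kappa>\<^sup>2 + 1/2 > 0" by (simp add: add_nonneg_pos)
    have "h * h = (sqrt 2 / 2)\<^sup>2 / (sqrt (\<kappa>\<^sup>2 + (sqrt 2 / 2)\<^sup>2))\<^sup>2"
      by (simp only: h_def sigmoid_def power_divide flip: power2_eq_square)
    also have "\<dots> = (1/2) / (\<kappa>\<^sup>2 + 1/2)" using pos by (simp add: power_divide)
    also have "\<dots> = 1 / (1 + 2 * \<kappa>\<^sup>2)" using pos by (simp add: field_simps)
    finally show ?thesis .
  qed
  have mono: "sigmoid \<kappa> u \<le> sigmoid \<kappa> v \<longleftrightarrow> u \<le> v" for u v
    using sigmoid_strict_mono[OF \<kappa>] by (rule strict_mono_less_eq)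
  have s0: "sigmoid \<kappa> 0 = 0" by (simp add: sigmoid_def)
  define P' where "P' u = \<kappa>\<^sup>2 / sqrt (\<kappa>\<^sup>2 + u\<^sup>2) ^ 3" for u
  have P': "P' u \<ge> 0" for u unfolding P'_def using sigmoid_denominator_pos[OF \<kappa>, of u] by auto
  have "(Y has_real_derivative P' (sin (2 * pi * s)) * (cos (2 * pi * s) * (2*pi))) (at s)" for s
    unfolding Y_def P'_def
    by (rule DERIV_chain2[where f = "sigmoid \<kappa>", OF sigmoid_has_derivative[OF \<kappa>]])
       (auto intro!: derivative_eq_intros)
  then have Y': "Y' s = P' (sin (2 * pi * s)) * (cos (2 * pi * s) * (2*pi))" for s
    using DERIV_unique Y by blast
  have per: "cos (2*pi*(s+1)) = cos (2 * pi * s)" "sin (2*pi*(s+1)) = sin (2 * pi * s)" for s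
    using cos_sin_2pi_eq_iff[of "s+1" s] by auto
  have inc: "G (s + 1) - G s = G 1 - G 0" for s
  proof -
    have "((\<lambda>s. G (s + 1) - G s) has_real_derivative 0) (at s)" for s
    proof -
      have "((\<lambda>s. G (s + 1)) has_real_derivative sigmoid \<kappa> (cos (2*pi*(s+1))) * Y' (s+1)) (at s)"
        using G[of "s + 1"] by (simp only: DERIV_shift)
      from DERIV_diff[OF this G[of s]] show ?thesis by (simp only: per Y' diff_self)
    qed
    from DERIV_isconst_all[of "\<lambda>s. G (s + 1) - G s", OF allI[OF this]] have "G (s + 1) - G s = G (0 + 1) - G 0" by blast
    then show ?thesis by simp
  qed
  show "G (s + 1) - G s = G 1 - G 0" by (rule inc)
  have mono_G: "G a \<le> G b" if "a \<le> b" for a b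
  proof (rule DERIV_nonneg_imp_nondecreasing[OF that])
    fix x
    have "0 \<le> sigmoid \<kappa> c * (P' u * (c * (2*pi)))" for c u
    proof (cases "c \<ge> 0")
      case True
      then show ?thesis using mono[of 0 c] s0 P' by simp
    next
      case False
      then have "sigmoid \<kappa> c \<le> 0" using mono[of c 0] s0 by simp
      moreover have "P' u * (c * (2*pi)) \<le> 0"
        using False P'[of u] by (intro mult_nonneg_nonpos mult_nonpos_nonneg) auto
      ultimately show ?thesis by (rule mult_nonpos_nonpos)
    qed
    then show "\<exists>y. DERIV G x :> y \<and> 0 \<le> y" using G[of x] unfolding Y' by blast
  qed
  have c8: "sqrt 2 / 2 \<le> cos (2*pi*x)" if "\<bar>x\<bar> \<le> 1/8" for x
  proof -
    have "\<bar>2*pi*x\<bar> \<le> pi/4" using that by (simp add: abs_mult field_simps)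
    then have "cos (pi/4) \<le> cos \<bar>2*pi*x\<bar>" by (intro cos_monotone_0_pi_le) auto
    then show ?thesis by (simp add: cos_45)
  qed
  have right: "G (1/8) - h * Y (1/8) \<ge> G (-1/8) - h * Y (-1/8)"
  proof (rule DERIV_nonneg_imp_nondecreasing[where f = "\<lambda>s. G s - h * Y s"])
    fix x :: real assume "-1/8 \<le> x" "x \<le> 1/8"
    then have c: "sqrt 2 / 2 \<le> cos (2*pi*x)" by (intro c8) auto
    then have "h \<le> sigmoid \<kappa> (cos (2*pi*x))" unfolding h_def mono .
    moreover have "Y' x \<ge> 0" unfolding Y' using P' order_trans[OF _ c, of 0] by simp
    ultimately have "0 \<le> (sigmoid \<kappa> (cos (2*pi*x)) - h) * Y' x" by simp
    moreover have "((\<lambda>s. G s - h * Y s) has_real_derivative (sigmoid \<kappa> (cos (2*pi*x)) - h) * Y' x) (at x)"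
      by (auto intro!: derivative_eq_intros G Y simp: algebra_simps)
    ultimately show "\<exists>y. DERIV (\<lambda>s. G s - h * Y s) x :> y \<and> 0 \<le> y" by blast
  qed simp
  have left: "G (5/8) + h * Y (5/8) \<ge> G (3/8) + h * Y (3/8)"
  proof (rule DERIV_nonneg_imp_nondecreasing[where f = "\<lambda>s. G s + h * Y s"])
    fix x :: real assume "3/8 \<le> x" "x \<le> 5/8"
    then have "\<bar>x - 1/2\<bar> \<le> 1/8" unfolding abs_le_iff by simp
    then have "sqrt 2 / 2 \<le> cos (2*pi*(x - 1/2))" by (rule c8)
    also have "2*pi*(x - 1/2) = 2*pi*x - pi" by (simp add: algebra_simps)
    finally have c: "sqrt 2 / 2 \<le> - cos (2*pi*x)" by (simp add: cos_diff)
    then have "h \<le> sigmoid \<kappa> (- cos (2*pi*x))" unfolding h_def mono .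
    then have "sigmoid \<kappa> (cos (2*pi*x)) + h \<le> 0" by (simp add: sigmoid_minus)
    moreover have "cos (2*pi*x) \<le> 0" using order_trans[OF _ c, of 0] by simp
    then have "Y' x \<le> 0" unfolding Y' using P' by (intro mult_nonneg_nonpos mult_nonpos_nonneg) auto
    ultimately have "0 \<le> (sigmoid \<kappa> (cos (2*pi*x)) + h) * Y' x" by (rule mult_nonpos_nonpos)
    moreover have "((\<lambda>s. G s + h * Y s) has_real_derivative (sigmoid \<kappa> (cos (2*pi*x)) + h) * Y' x) (at x)"
      by (auto intro!: derivative_eq_intros G Y simp: algebra_simps)
    ultimately show "\<exists>y. DERIV (\<lambda>s. G s + h * Y s) x :> y \<and> 0 \<le> y" by blast
  qed simp
  have vals: "Y (1/8) = h" "Y (-1/8) = - h" "Y (3/8) = h" "Y (5/8) = - h"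
  proof -
    have "sin (2*pi*(1/8)) = sqrt 2 / 2" using sin_45 by (simp add: field_simps)
    moreover have "sin (2*pi*(-1/8)) = - (sqrt 2 / 2)" using sin_45 by (simp add: field_simps)
    moreover have "2*pi*(3/8) = pi - pi/4" "2*pi*(5/8) = pi + pi/4" by simp_all
    then have "sin (2*pi*(3/8)) = sqrt 2 / 2" "sin (2*pi*(5/8)) = - (sqrt 2 / 2)"
      using sin_45 by (simp_all only: sin_diff sin_add) (simp_all)
    ultimately show "Y (1/8) = h" "Y (-1/8) = - h" "Y (3/8) = h" "Y (5/8) = - h"
      unfolding Y_def h_def by (simp_all only: sigmoid_minus)
  qed
  have "G 1 - G 0 = G (7/8) - G (-1/8)" using inc[of "-1/8"] by simp
  also have "\<dots> \<ge> (G (5/8) - G (3/8)) + (G (1/8) - G (-1/8))"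
    using mono_G[of "5/8" "7/8"] mono_G[of "1/8" "3/8"] by simp
  finally have "G 1 - G 0 \<ge> (G (5/8) - G (3/8)) + (G (1/8) - G (-1/8))" .
  moreover have "(G (5/8) - G (3/8)) + (G (1/8) - G (-1/8)) \<ge> 4 * (h * h)"
    using right left unfolding vals by simp
  ultimately show "G 1 - G 0 \<ge> 4 / (1 + 2 * \<kappa>\<^sup>2)" unfolding h2 by simp
qed

text \<open>
  A smooth embedded closed curve \<open>(x, y)\<close> of area 1 in a rectangle of area \<open>1 + \<delta>\<close>. The function \<open>G\<close> is an
  antiderivative of \<open>x y'\<close>, so its increment over a period is the enclosed area.
\<close>
locale unit_area_curve =
  fixes \<delta> :: real and x y x' y' G :: "real \<Rightarrow> real"
  assumes elementary_x: "(\<lambda>p. x (fst p)) \<in> elementary"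
    and elementary_y: "(\<lambda>p. y (fst p)) \<in> elementary"
    and x_bound: "\<And>s. \<bar>x s\<bar> < (1 + \<delta>) / 2"
    and y_bound: "\<And>s. \<bar>y s\<bar> < 1 / 2"
    and xy_eq_iff: "\<And>s t. x s = x t \<and> y s = y t \<longleftrightarrow> s - t \<in> \<int>"
    and x_deriv: "\<And>s. (x has_real_derivative x' s) (at s)"
    and y_deriv: "\<And>s. (y has_real_derivative y' s) (at s)"
    and xy_immersed: "\<And>s. x' s \<noteq> 0 \<or> y' s \<noteq> 0"
    and G_deriv: "\<And>s. (G has_real_derivative x s * y' s) (at s)"
    and G_period: "\<And>s. G (s + 1) = G s + 1"

text \<open>
  Stretch a rounded square of area \<open>A > 4 / (1 + \<delta>)\<close>, which lies in \<open>(-1, 1)\<^sup>2\<close>, by the factor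
  \<open>(1 + \<delta>) / 2\<close> in one direction and by the factor that normalises the area in the other; the bound on \<open>A\<close>
  makes the second factor less than \<open>1/2\<close>.
\<close>
lemma unit_area_curve_exists:
  assumes "\<delta> > 0"
  shows "\<exists>x y x' y' G. unit_area_curve \<delta> x y x' y' G"
proof -
  \<comment> \<open>chosen so that the lower bound \<open>4 / (1 + 2 \<kappa>\<^sup>2)\<close> for the area exceeds \<open>4 / (1 + \<delta>)\<close>\<close>
  define \<kappa> where "\<kappa> = sqrt (\<delta> / 4)"
  have \<kappa>: "\<kappa> > 0" "\<kappa>\<^sup>2 = \<delta> / 4" using assms by (auto simp: \<kappa>_def)
  define X Y where "X = (\<lambda>s. sigmoid \<kappa> (cos (2 * pi * s)))" and "Y = (\<lambda>s. sigmoid \<kappa> (sin (2 * pi * s)))"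
  define P' where "P' u = \<kappa>\<^sup>2 / sqrt (\<kappa>\<^sup>2 + u\<^sup>2) ^ 3" for u
  have P': "P' u > 0" for u unfolding P'_def using sigmoid_denominator_pos[OF \<kappa>(1), of u] \<kappa>(1) by auto
  define X' Y' where "X' = (\<lambda>s. P' (cos (2 * pi * s)) * (- sin (2 * pi * s) * (2*pi)))"
    and "Y' = (\<lambda>s. P' (sin (2 * pi * s)) * (cos (2 * pi * s) * (2*pi)))"
  have X: "(X has_real_derivative X' s) (at s)" for s
    unfolding X_def X'_def P'_def
    by (rule DERIV_chain2[where f = "sigmoid \<kappa>", OF sigmoid_has_derivative[OF \<kappa>(1)]])
       (auto intro!: derivative_eq_intros)
  have Y: "(Y has_real_derivative Y' s) (at s)" for s
    unfolding Y_def Y'_def P'_def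
    by (rule DERIV_chain2[where f = "sigmoid \<kappa>", OF sigmoid_has_derivative[OF \<kappa>(1)]])
       (auto intro!: derivative_eq_intros)
  have "continuous_on UNIV (\<lambda>s. X s * Y' s)"
  proof -
    have "continuous_on UNIV X" using X by (rule DERIV_continuous_on)
    moreover have "continuous_on UNIV Y'"
      unfolding Y'_def P'_def using sigmoid_denominator_pos[OF \<kappa>(1)]
      by (auto intro!: continuous_intros simp: less_imp_neq[symmetric])
    ultimately show ?thesis by (rule continuous_on_mult)
  qed
  then obtain G where G: "\<And>s. (G has_real_derivative X s * Y' s) (at s)"
    using continuous_antiderivative_real by blast
  define A where "A = G 1 - G 0"
  have GX: "(G has_real_derivative sigmoid \<kappa> (cos (2 * pi * s)) * Y' s) (at s)" for s
    using G[of s] by (simp only: X_def)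
  have inc: "G (s + 1) = G s + A" for s
    using rounded_square_area(1)[OF \<kappa>(1) Y Y_def GX, of s] by (simp add: A_def)
  have "A \<ge> 4 / (1 + 2 * \<kappa>\<^sup>2)"
    using rounded_square_area(2)[OF \<kappa>(1) Y Y_def GX] by (simp add: A_def)
  then have "A \<ge> 4 / (1 + \<delta> / 2)" by (simp add: \<kappa>)
  moreover have "4 / (1 + \<delta> / 2) > 4 / (1 + \<delta>)" using assms by (simp add: field_simps)
  ultimately have A: "A > 4 / (1 + \<delta>)" by simp
  then have A0: "A > 0" using assms by (smt (verit) divide_pos_pos)
  define \<alpha> \<beta> where "\<alpha> = (1 + \<delta>) / 2" and "\<beta> = 2 / ((1 + \<delta>) * A)"
  have ab: "\<alpha> > 0" "\<beta> > 0" "\<beta> < 1/2" "\<alpha> * \<beta> * A = 1"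
    using assms A A0 by (auto simp: \<alpha>_def \<beta>_def field_simps)
  have "unit_area_curve \<delta> (\<lambda>s. \<alpha> * X s) (\<lambda>s. \<beta> * Y s) (\<lambda>s. \<alpha> * X' s) (\<lambda>s. \<beta> * Y' s) (\<lambda>s. \<alpha> * \<beta> * G s)"
  proof
    show "(\<lambda>p. \<alpha> * X (fst p)) \<in> elementary" "(\<lambda>p. \<beta> * Y (fst p)) \<in> elementary"
      unfolding X_def Y_def by (intro elementary_intros elementary_sigmoid \<kappa>)+
    show "\<bar>\<alpha> * X s\<bar> < (1 + \<delta>) / 2" for s
    proof -
      have "\<alpha> * \<bar>X s\<bar> < \<alpha> * 1"
        unfolding X_def using ab abs_sigmoid_less_1[OF \<kappa>(1)] by (intro mult_strict_left_mono)
      then show ?thesis using ab by (simp add: abs_mult \<alpha>_def)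
    qed
    show "\<bar>\<beta> * Y s\<bar> < 1 / 2" for s
    proof -
      have "\<beta> * \<bar>Y s\<bar> < \<beta> * 1"
        unfolding Y_def using ab abs_sigmoid_less_1[OF \<kappa>(1)] by (intro mult_strict_left_mono)
      then have "\<beta> * \<bar>Y s\<bar> < 1/2" using ab(3) by linarith
      then show ?thesis using ab by (simp add: abs_mult)
    qed
    show "\<alpha> * X s = \<alpha> * X t \<and> \<beta> * Y s = \<beta> * Y t \<longleftrightarrow> s - t \<in> \<int>" for s t
      using ab cos_sin_2pi_eq_iff[of s t] strict_mono_eq[OF sigmoid_strict_mono[OF \<kappa>(1)]]
      by (simp add: X_def Y_def)
    show "((\<lambda>s. \<alpha> * X s) has_real_derivative \<alpha> * X' s) (at s)"
      "((\<lambda>s. \<beta> * Y s) has_real_derivative \<beta> * Y' s) (at s)" for s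
      by (intro DERIV_cmult X Y)+
    show "\<alpha> * X' s \<noteq> 0 \<or> \<beta> * Y' s \<noteq> 0" for s
    proof -
      have "P' u \<noteq> 0" for u using P'[of u] by simp
      then show ?thesis
        using ab sin_cos_squared_add[of "2 * pi * s"] by (auto simp: X'_def Y'_def simp del: sin_cos_squared_add)
    qed
    show "((\<lambda>s. \<alpha> * \<beta> * G s) has_real_derivative \<alpha> * X s * (\<beta> * Y' s)) (at s)" for s
      using DERIV_cmult[OF G[of s], of "\<alpha> * \<beta>"] by (simp add: mult_ac)
    show "\<alpha> * \<beta> * G (s + 1) = \<alpha> * \<beta> * G s + 1" for s
      unfolding inc distrib_left ab(4) ..
  qed
  then show ?thesis by blast
qed

section \<open>The twisted torus\<close>

text \<open>
  The scales are nested, \<open>\<delta>\<close> much smaller than \<open>\<eta>\<close>, so that the term \<open>m' y\<close> of the first action, of size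
  \<open>2 \<pi> \<delta>\<close>, cannot spoil the margin \<open>3 \<eta> / 16\<close> by which that action stays away from the integers.
\<close>
locale twisted_torus = unit_area_curve +
  fixes \<eta> :: real
  assumes \<delta>: "0 < \<delta>" "50 * \<delta> \<le> \<eta>"
    and \<eta>: "4 * \<eta> \<le> 1"
begin

definition C :: "real \<Rightarrow> real" where "C t = cos (2 * pi * t)"
definition S :: "real \<Rightarrow> real" where "S t = sin (2 * pi * t)"

definition action2 :: "real \<times> real \<Rightarrow> real" where
  "action2 p = 3 / 2 + 2 * \<delta> * C (snd p) + x (fst p)"

text \<open>
  This equals \<open>b + K' x + m' y\<close> with \<open>K' = 1 - 2 \<eta> c\<close>, \<open>m = 2 \<delta> c\<close> and
  \<open>b = 3/2 + m + \<eta> (c\<^sup>2 - 1/2 - 2 c m)\<close>, where \<open>c = cos 2\<pi>t\<close>. In this form it is visibly close to the second action.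
\<close>
definition action1 :: "real \<times> real \<Rightarrow> real" where
  "action1 p = action2 p + \<eta> * ((C (snd p))\<^sup>2 - 1 / 2 - 2 * C (snd p) * (2 * \<delta> * C (snd p) + x (fst p)))
     - 4 * pi * \<delta> * S (snd p) * y (fst p)"

definition angle2 :: "real \<times> real \<Rightarrow> real" where
  "angle2 p = y (fst p) - (snd p - \<eta> / pi * S (snd p))"

definition torus :: "real \<times> real \<Rightarrow> complex \<times> complex" where
  "torus p = (action_angle (action1 p) (snd p), action_angle (action2 p) (angle2 p))"

lemma CS_bounds: "\<bar>C t\<bar> \<le> 1" "\<bar>S t\<bar> \<le> 1"
  by (simp_all add: C_def S_def)

lemma \<eta>_pos: "\<eta> > 0"
  using \<delta> by linarith

lemma y_term_bound: "\<bar>4 * pi * \<delta> * S t * y s\<bar> < 7 * \<delta>"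
proof -
  have "\<bar>S t * y s\<bar> \<le> 1 * (1/2)"
    unfolding abs_mult using CS_bounds[of t] y_bound[of s] by (intro mult_mono) auto
  then have "4 * pi * \<delta> * \<bar>S t * y s\<bar> \<le> 4 * pi * \<delta> * (1/2)"
    using \<delta> by (intro mult_left_mono) auto
  also have "\<dots> < 7 * \<delta>" using pi_less_4 pi_approx \<delta> by simp
  finally show ?thesis using \<delta> by (simp add: abs_mult mult.assoc)
qed

lemma action2_bounds: "1 - 3 * \<delta> < action2 p" "action2 p < 2 + 3 * \<delta>"
proof -
  define q where "q = 2 * \<delta> * C (snd p)"
  have "2 * \<delta> * \<bar>C (snd p)\<bar> \<le> 2 * \<delta> * 1"
    using CS_bounds \<delta> by (intro mult_left_mono) auto
  then have "\<bar>q\<bar> \<le> 2 * \<delta>" using \<delta> by (simp add: q_def abs_mult)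
  moreover have "action2 p = 3 / 2 + q + x (fst p)" by (simp add: action2_def q_def)
  moreover have "x (fst p) < (1 + \<delta>) / 2 \<and> - x (fst p) < (1 + \<delta>) / 2"
    using x_bound[of "fst p"] unfolding abs_less_iff .
  ultimately show "1 - 3 * \<delta> < action2 p" "action2 p < 2 + 3 * \<delta>"
    using \<delta>(1) by (simp_all add: abs_le_iff field_simps)
qed

lemma action1_close: "\<bar>action1 p - action2 p\<bar> < 2 * \<eta>"
proof -
  define c where "c = C (snd p)"
  define w where "w = 2 * \<delta> * c + x (fst p)"
  have c: "\<bar>c\<bar> \<le> 1" unfolding c_def by (rule CS_bounds)
  have w: "\<bar>w\<bar> \<le> 1/2 + 3 * \<delta>"
    using action2_bounds[of p] unfolding w_def c_def action2_def by linarith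
  have "\<bar>c * w\<bar> \<le> 1 * (1/2 + 3 * \<delta>)" unfolding abs_mult using c w by (intro mult_mono) auto
  moreover have "0 \<le> c\<^sup>2" "c\<^sup>2 \<le> 1" using c by (auto simp: abs_square_le_1)
  ultimately have "c\<^sup>2 - 1/2 - 2 * (c * w) \<le> 3/2 + 6 * \<delta>" "- (c\<^sup>2 - 1/2 - 2 * (c * w)) \<le> 3/2 + 6 * \<delta>"
    unfolding abs_le_iff by argo+
  then have "\<bar>c\<^sup>2 - 1/2 - 2 * c * w\<bar> \<le> 3/2 + 6 * \<delta>" by (simp add: abs_le_iff mult.assoc)
  then have "\<bar>\<eta> * (c\<^sup>2 - 1/2 - 2 * c * w)\<bar> \<le> \<eta> * (3/2 + 6 * \<delta>)"
    unfolding abs_mult using \<eta>_pos by (intro mult_mono) auto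
  also have "\<dots> \<le> \<eta> * (3/2 + 6/200)" using \<delta> \<eta> \<eta>_pos by (intro mult_left_mono) auto
  finally have "\<bar>\<eta> * (c\<^sup>2 - 1/2 - 2 * c * w)\<bar> \<le> 153/100 * \<eta>" by simp
  moreover have "action1 p - action2 p = \<eta> * (c\<^sup>2 - 1/2 - 2 * c * w) - 4 * pi * \<delta> * S (snd p) * y (fst p)"
    by (simp add: action1_def c_def w_def)
  moreover have "\<bar>P - Q\<bar> < 2 * \<eta>" if "\<bar>P\<bar> \<le> 153/100 * \<eta>" "\<bar>Q\<bar> < 7 * \<delta>" for P Q
    using that \<delta> \<eta>_pos by linarith
  ultimately show ?thesis using y_term_bound[of "snd p" "fst p"] by metis
qed

lemma action_bounds:
  "0 < action1 p" "0 < action2 p" "action1 p < 2 + 4 * \<eta>" "action2 p < 2 + 4 * \<eta>"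
  using action1_close[of p] action2_bounds[of p] \<delta> \<eta> by linarith+

text \<open>
  The correction \<open>c\<^sup>2 + c - 1/2\<close> has mean value 0 over a period of \<open>c = cos 2\<pi>t\<close> but is negative on more than
  half of the period.
\<close>
lemma quadratic_bound: "c\<^sup>2 + c - 1/2 \<le> -3/16" if "-1 \<le> c" "c \<le> 1/4" for c :: real
proof -
  have "(c - 1/4) * (c + 5/4) \<le> 0" using that by (intro mult_nonpos_nonneg) auto
  moreover have "(c - 1/4) * (c + 5/4) = c\<^sup>2 + c - 5/16" by (simp add: power2_eq_square field_simps)
  ultimately show ?thesis by simp
qed

text \<open>
  The pushed curve reaches down to \<open>A\<^sub>2 = 1\<close> only if \<open>m < \<delta> / 2\<close>, that is, \<open>c < 1/4\<close>; there the correction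
  to \<open>A\<^sub>1 = 1\<close> is negative.
\<close>
lemma action1_if_action2_eq_1:
  assumes "action2 p = 1"
  shows "0 < action1 p" "action1 p < 1"
proof -
  define c where "c = C (snd p)"
  have w: "2 * \<delta> * c + x (fst p) = -1/2" using assms by (simp add: action2_def c_def)
  then have "\<delta> * c \<le> \<delta> * (1/4)" using x_bound[of "fst p"] by (simp add: abs_less_iff field_simps)
  then have "c \<le> 1/4" using \<delta> by (simp only: mult_le_cancel_left_pos)
  then have "c\<^sup>2 + c - 1/2 \<le> -3/16" using CS_bounds[of "snd p"] by (intro quadratic_bound) (auto simp: c_def abs_le_iff)
  then have "\<eta> * (c\<^sup>2 + c - 1/2) \<le> \<eta> * (-3/16)" using \<eta>_pos by (intro mult_left_mono) auto
  moreover have "action1 p = 1 + \<eta> * (c\<^sup>2 - 1/2 - 2 * c * (-1/2)) - 4 * pi * \<delta> * S (snd p) * y (fst p)"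
    unfolding action1_def assms c_def[symmetric] w ..
  ultimately show "action1 p < 1"
    using y_term_bound[of "snd p" "fst p"] \<delta> \<eta>_pos by (simp add: algebra_simps abs_less_iff)
  show "0 < action1 p" by (rule action_bounds)
qed

text \<open>
  Symmetric to the previous lemma under \<open>c \<mapsto> -c\<close>: the curve reaches up to \<open>A\<^sub>2 = 2\<close> only if \<open>c > -1/4\<close>.
\<close>
lemma action1_if_action2_eq_2:
  assumes "action2 p = 2"
  shows "1 < action1 p" "action1 p < 2"
proof -
  define c where "c = C (snd p)"
  have w: "2 * \<delta> * c + x (fst p) = 1/2" using assms by (simp add: action2_def c_def)
  then have "\<delta> * (- c) \<le> \<delta> * (1/4)" using x_bound[of "fst p"] by (simp add: abs_less_iff field_simps)
  then have "- c \<le> 1/4" using \<delta> by (simp only: mult_le_cancel_left_pos)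
  then have "(- c)\<^sup>2 + (- c) - 1/2 \<le> -3/16" using CS_bounds[of "snd p"]
    by (intro quadratic_bound) (auto simp: c_def abs_le_iff)
  then have "\<eta> * ((- c)\<^sup>2 + (- c) - 1/2) \<le> \<eta> * (-3/16)" using \<eta>_pos by (intro mult_left_mono) auto
  moreover have "action1 p = 2 + \<eta> * (c\<^sup>2 - 1/2 - 2 * c * (1/2)) - 4 * pi * \<delta> * S (snd p) * y (fst p)"
    unfolding action1_def assms c_def[symmetric] w ..
  ultimately show "action1 p < 2"
    using y_term_bound[of "snd p" "fst p"] \<delta> \<eta>_pos by (simp add: algebra_simps abs_less_iff)
  show "1 < action1 p" using action1_close[of p] assms \<eta> by linarith
qed

lemma range_torus_subset: "range torus \<subseteq> polydisk (2 + 4 * \<eta>) (2 + 4 * \<eta>)"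
  using action_bounds
  by (auto simp: torus_def polydisk_def area_action_angle less_imp_le)

lemma range_torus_disjoint: "range torus \<inter> product_torus k l = {}"
proof -
  have False if "action1 p = real k" "action2 p = real l" for p
  proof -
    have "0 < action2 p" "action2 p < 3" using action_bounds[of p] \<eta> by auto
    then have "0 < l" "l < 3" using that by simp_all
    then consider "l = 1" | "l = 2" by linarith
    then show False
    proof cases
      case 1
      then show ?thesis using action1_if_action2_eq_1[of p] that by simp
    next
      case 2
      then show ?thesis using action1_if_action2_eq_2[of p] that by simp
    qed
  qed
  then show ?thesis
    using action_bounds
    by (fastforce simp: torus_def product_torus_def area_action_angle less_imp_le)
qed

lemma C_deriv: "(C has_real_derivative - (2 * pi * S t)) (at t)"
  unfolding C_def[abs_def] S_def by (auto intro!: derivative_eq_intros)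

lemma S_deriv: "(S has_real_derivative 2 * pi * C t) (at t)"
  unfolding C_def S_def[abs_def] by (auto intro!: derivative_eq_intros)

lemmas coordinate_derivs =
  DERIV_compose_FDERIV[OF x_deriv has_derivative_fst[OF has_derivative_ident]]
  DERIV_compose_FDERIV[OF y_deriv has_derivative_fst[OF has_derivative_ident]]
  DERIV_compose_FDERIV[OF C_deriv has_derivative_snd[OF has_derivative_ident]]
  DERIV_compose_FDERIV[OF S_deriv has_derivative_snd[OF has_derivative_ident]]

definition daction2 :: "real \<times> real \<Rightarrow> real \<times> real \<Rightarrow> real" where
  "daction2 p v = x' (fst p) * fst v - 4 * pi * \<delta> * S (snd p) * snd v"

definition dangle2 :: "real \<times> real \<Rightarrow> real \<times> real \<Rightarrow> real" where
  "dangle2 p v = y' (fst p) * fst v - (1 - 2 * \<eta> * C (snd p)) * snd v"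

definition daction1_dt :: "real \<times> real \<Rightarrow> real" where
  "daction1_dt p = - 4 * pi * \<delta> * S (snd p)
     + \<eta> * (- 4 * pi * S (snd p) * C (snd p) + 4 * pi * S (snd p) * (2 * \<delta> * C (snd p) + x (fst p))
            + 8 * pi * \<delta> * S (snd p) * C (snd p))
     - 8 * pi * pi * \<delta> * C (snd p) * y (fst p)"

definition daction1 :: "real \<times> real \<Rightarrow> real \<times> real \<Rightarrow> real" where
  "daction1 p v = ((1 - 2 * \<eta> * C (snd p)) * x' (fst p) - 4 * pi * \<delta> * S (snd p) * y' (fst p)) * fst v
     + daction1_dt p * snd v"

lemma action2_deriv: "(action2 has_derivative daction2 p) (at p)"
  unfolding action2_def[abs_def]
  by (rule coordinate_derivs derivative_eq_intros refl)+
    (simp add: fun_eq_iff daction2_def algebra_simps)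

lemma angle2_deriv: "(angle2 has_derivative dangle2 p) (at p)"
  unfolding angle2_def[abs_def]
  by (rule coordinate_derivs derivative_eq_intros refl)+
    (simp add: fun_eq_iff dangle2_def algebra_simps)

lemma action1_deriv: "(action1 has_derivative daction1 p) (at p)"
  unfolding action1_def[abs_def]
  by (rule coordinate_derivs derivative_eq_intros action2_deriv refl)+
    (simp add: fun_eq_iff daction1_def daction1_dt_def daction2_def algebra_simps power2_eq_square)

definition dtorus :: "real \<times> real \<Rightarrow> real \<times> real \<Rightarrow> complex \<times> complex" where
  "dtorus p v =
     (fst (torus p) * Complex (daction1 p v / (2 * action1 p)) (2 * pi * snd v),
      snd (torus p) * Complex (daction2 p v / (2 * action2 p)) (2 * pi * dangle2 p v))"

lemma torus_deriv: "(torus has_derivative dtorus p) (at p)"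
proof -
  have "((\<lambda>p. action_angle (action1 p) (snd p)) has_derivative
      (\<lambda>v. action_angle (action1 p) (snd p) * Complex (daction1 p v / (2 * action1 p)) (2 * pi * snd v))) (at p)"
    by (intro has_derivative_action_angle action1_deriv action_bounds has_derivative_snd has_derivative_ident)
  moreover have "((\<lambda>p. action_angle (action2 p) (angle2 p)) has_derivative
      (\<lambda>v. action_angle (action2 p) (angle2 p) * Complex (daction2 p v / (2 * action2 p)) (2 * pi * dangle2 p v))) (at p)"
    by (intro has_derivative_action_angle action2_deriv angle2_deriv action_bounds)
  ultimately show ?thesis
    unfolding torus_def[abs_def] dtorus_def[abs_def] fst_conv snd_conv by (rule has_derivative_Pair)
qed

lemma frechet_derivative_torus: "frechet_derivative torus (at p) = dtorus p"
  using frechet_derivative_at[OF torus_deriv] ..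

lemma symplectic_dtorus:
  "std_symplectic (dtorus p v) (dtorus p w)
     = (daction1 p v * snd w - snd v * daction1 p w) + (daction2 p v * dangle2 p w - dangle2 p v * daction2 p w)"
  unfolding std_symplectic_def dtorus_def fst_conv snd_conv torus_def
    action_angle_forms(1)[OF action_bounds(1)] action_angle_forms(1)[OF action_bounds(2)] ..

lemma liouville_dtorus:
  "liouville (torus p) (dtorus p v) = action1 p * snd v + action2 p * dangle2 p v"
  unfolding liouville_def std_symplectic_def dtorus_def fst_conv snd_conv torus_def
    action_angle_forms(2)[OF action_bounds(1)] action_angle_forms(2)[OF action_bounds(2)] by simp

text \<open>
  On a surface it suffices that \<open>dA\<^sub>1 \<and> dt + dA\<^sub>2 \<and> d\<theta>\<^sub>2\<close> vanishes; its coefficient is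
  \<open>(K' x' + m' y') - x' K' - m' y' = 0\<close>, which is why \<open>A\<^sub>1\<close> was chosen as it was.
\<close>
lemma lagrangian_dtorus: "std_symplectic (dtorus p v) (dtorus p w) = 0"
  unfolding symplectic_dtorus daction1_def daction2_def dangle2_def by (simp add: algebra_simps)

lemma inj_dtorus: "inj (dtorus p)"
proof -
  have "v = 0" if "dtorus p v = 0" for v
  proof -
    have "Complex (daction1 p v / (2 * action1 p)) (2 * pi * snd v) = 0"
      "Complex (daction2 p v / (2 * action2 p)) (2 * pi * dangle2 p v) = 0"
      using that action_angle_forms(3)[OF action_bounds(1)] action_angle_forms(3)[OF action_bounds(2)]
      by (auto simp: dtorus_def torus_def zero_prod_def)
    then have "snd v = 0" "daction2 p v = 0" "dangle2 p v = 0"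
      using action_bounds[of p] by (auto simp: complex_eq_iff)
    then have "snd v = 0" "x' (fst p) * fst v = 0" "y' (fst p) * fst v = 0"
      by (auto simp: daction2_def dangle2_def)
    then show ?thesis using xy_immersed[of "fst p"] by (auto simp: prod_eq_iff)
  qed
  then show ?thesis
    using linear_injective_0[OF has_derivative_linear[OF torus_deriv[of p]]] by blast
qed

lemma CS_periodic: "C t = C u" "S t = S u" if "t - u \<in> \<int>"
  using that cos_sin_2pi_eq_iff[of t u] by (auto simp: C_def S_def)

text \<open>
  The first angle recovers \<open>t\<close> modulo 1, then the second action recovers \<open>x\<close> and the second angle recovers
  \<open>y\<close> modulo 1. The bound \<open>|y| < 1/2\<close> removes the last ambiguity.
\<close>
lemma torus_eq_iff: "torus p = torus q \<longleftrightarrow> fst p - fst q \<in> \<int> \<and> snd p - snd q \<in> \<int>"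
proof
  assume "torus p = torus q"
  then have act: "action2 p = action2 q" and ang: "snd p - snd q \<in> \<int>" "angle2 p - angle2 q \<in> \<int>"
    using action_bounds by (auto simp: torus_def action_angle_eq_iff)
  note per = CS_periodic[OF ang(1)]
  have x: "x (fst p) = x (fst q)" using act by (simp add: action2_def per)
  have "y (fst p) - y (fst q) = (angle2 p - angle2 q) + (snd p - snd q)"
    by (simp add: angle2_def per)
  also have "\<dots> \<in> \<int>" using ang by (intro Ints_add)
  finally have "y (fst p) - y (fst q) \<in> \<int>" .
  moreover have "\<bar>y (fst p) - y (fst q)\<bar> < 1" using y_bound[of "fst p"] y_bound[of "fst q"] by linarith
  ultimately obtain n where "y (fst p) - y (fst q) = of_int n" "\<bar>of_int n :: real\<bar> < 1"
    by (auto elim!: Ints_cases)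
  then have "y (fst p) = y (fst q)" by (simp flip: of_int_abs)
  with x ang show "fst p - fst q \<in> \<int> \<and> snd p - snd q \<in> \<int>" using xy_eq_iff by blast
next
  assume *: "fst p - fst q \<in> \<int> \<and> snd p - snd q \<in> \<int>"
  then have xy: "x (fst p) = x (fst q)" "y (fst p) = y (fst q)" using xy_eq_iff by blast+
  have per: "C (snd p) = C (snd q)" "S (snd p) = S (snd q)" using * by (auto intro: CS_periodic)
  have act: "action2 p = action2 q" by (simp add: action2_def per xy)
  then have "action1 p = action1 q" by (simp add: action1_def per xy)
  moreover have "angle2 p - angle2 q = - (snd p - snd q)" by (simp add: angle2_def per xy)
  then have "angle2 p - angle2 q \<in> \<int>" using * by (metis Ints_minus)
  ultimately show "torus p = torus q"
    using act * action_bounds by (simp add: torus_def action_angle_eq_iff)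
qed

lemma torus_embedding_torus: "torus_embedding torus"
proof -
  have CS: "(\<lambda>p. C (snd p)) \<in> elementary" "(\<lambda>p. S (snd p)) \<in> elementary"
    unfolding C_def S_def by (intro elementary_intros)+
  have 2: "action2 \<in> elementary"
    unfolding action2_def[abs_def] by (intro elementary_intros CS elementary_x)
  then have 1: "action1 \<in> elementary"
    unfolding action1_def[abs_def] by (intro elementary_intros CS elementary_x elementary_y)
  have \<theta>: "angle2 \<in> elementary"
    unfolding angle2_def[abs_def] by (intro elementary_intros CS elementary_y)
  have "smooth_on UNIV torus"
    using smooth_on_elementary[OF elementary_action_angle[OF 1 action_bounds(1) elementary.snd]
        elementary_action_angle[OF 2 action_bounds(2) \<theta>]]
    by (simp add: torus_def[abs_def])
  then show ?thesis
    unfolding torus_embedding_def frechet_derivative_torus using torus_eq_iff inj_dtorus by blast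
qed

text \<open>
  The \<open>t\<close>-part is the antiderivative of \<open>\<eta> (c\<^sup>2 - 1/2 + 3 c)\<close>, which is \<open>A\<^sub>1 - K' A\<^sub>2 - m' y\<close>; it is periodic
  because the mean value of the integrand is 0. The middle term integrates \<open>(3/2 + m) dy + y dm\<close>, and \<open>G\<close>
  integrates \<open>x dy\<close>.
\<close>
definition primitive :: "real \<times> real \<Rightarrow> real" where
  "primitive p = \<eta> / (4 * pi) * (S (snd p) * C (snd p) + 6 * S (snd p))
     + (3 / 2 + 2 * \<delta> * C (snd p)) * y (fst p) + G (fst p)"

lemma primitive_deriv: "(primitive has_derivative (\<lambda>v. liouville (torus p) (dtorus p v))) (at p)"
proof -
  have pyth: "(S (snd p))\<^sup>2 = 1 - (C (snd p))\<^sup>2"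
    unfolding S_def C_def by (rule sin_squared_eq)
  have "(primitive has_derivative (\<lambda>v.
      \<eta> / (4 * pi) * (((2 * pi * C (snd p)) * C (snd p) + S (snd p) * - (2 * pi * S (snd p)) + 6 * (2 * pi * C (snd p))) * snd v)
      + ((2 * \<delta> * - (2 * pi * S (snd p)) * snd v) * y (fst p) + (3 / 2 + 2 * \<delta> * C (snd p)) * (y' (fst p) * fst v))
      + x (fst p) * y' (fst p) * fst v)) (at p)"
    unfolding primitive_def[abs_def]
    by (rule coordinate_derivs
          DERIV_compose_FDERIV[OF G_deriv has_derivative_fst[OF has_derivative_ident]] derivative_eq_intros refl)+
      (simp add: fun_eq_iff algebra_simps)
  moreover have "\<eta> / (4 * pi) * (((2 * pi * C (snd p)) * C (snd p) + S (snd p) * - (2 * pi * S (snd p)) + 6 * (2 * pi * C (snd p))) * snd v)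
      + ((2 * \<delta> * - (2 * pi * S (snd p)) * snd v) * y (fst p) + (3 / 2 + 2 * \<delta> * C (snd p)) * (y' (fst p) * fst v))
      + x (fst p) * y' (fst p) * fst v = liouville (torus p) (dtorus p v)" for v
  proof -
    have *: "(2 * pi * C (snd p)) * C (snd p) + S (snd p) * - (2 * pi * S (snd p)) + 6 * (2 * pi * C (snd p))
        = 4 * pi * ((C (snd p))\<^sup>2 - 1/2 + 3 * C (snd p))"
      using arg_cong[OF pyth, of "\<lambda>q. 2 * pi * q"] by (simp add: power2_eq_square algebra_simps)
    have "\<eta> / (4 * pi) * (4 * pi * a * snd v) = \<eta> * a * snd v" for a by simp
    then show ?thesis
      unfolding * liouville_dtorus action1_def action2_def dangle2_def
      by (simp add: algebra_simps power2_eq_square)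
  qed
  ultimately show ?thesis by simp
qed

lemma primitive_periods:
  "primitive (p + (1, 0)) - primitive p \<in> \<int>" "primitive (p + (0, 1)) - primitive p \<in> \<int>"
proof -
  have "y (fst p + 1) = y (fst p)" using xy_eq_iff[of "fst p + 1" "fst p"] by simp
  then show "primitive (p + (1, 0)) - primitive p \<in> \<int>" by (simp add: primitive_def G_period)
  show "primitive (p + (0, 1)) - primitive p \<in> \<int>"
    using CS_periodic[of "snd p + 1" "snd p"] by (simp add: primitive_def)
qed

lemma integral_lagrangian_torus_range:
  assumes "range torus \<subseteq> M"
  shows "integral_lagrangian_torus M (range torus)"
proof -
  have "lagrangian_torus M (range torus)"
    unfolding lagrangian_torus_def
    using assms torus_embedding_torus lagrangian_dtorus frechet_derivative_torus by auto
  moreover have "symplectic_area u \<in> \<int>"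
    if "c \<in> rel_pi2 M (range torus) p" "u \<in> c" "smooth_disc u" for c u p
  proof -
    have "u \<in> based_discs M (range torus) p"
      using that(1,2) unfolding rel_pi2_def quotient_def by auto
    then have "u ` sphere 0 1 \<subseteq> range torus" by (simp add: based_discs_def)
    then show ?thesis
      using symplectic_area_integer[OF torus_embedding_torus _ primitive_periods \<open>smooth_disc u\<close>]
        primitive_deriv by (simp add: frechet_derivative_torus)
  qed
  then have "Range (area_hom_graph M (range torus) p) \<subseteq> \<int>" for p
    unfolding area_hom_graph_def by blast
  ultimately show ?thesis
    unfolding integral_lagrangian_torus_def by blast
qed

end

section \<open>Integral tori that miss all integer fibres\<close>

lemma polydisk_mono: "a \<le> a' \<Longrightarrow> b \<le> b' \<Longrightarrow> polydisk a b \<subseteq> polydisk a' b'"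
  by (auto simp: polydisk_def)

text \<open>
  The integrality is stated for every ambient set at once, so that the same torus serves in the large and in
  the small polydisk.
\<close>
lemma integral_torus_disjoint_from_product_tori:
  fixes \<epsilon> :: real
  assumes "\<epsilon> > 0"
  obtains L where "L \<noteq> {}" "L \<subseteq> polydisk (2 + \<epsilon>) (2 + \<epsilon>)"
    "\<And>M. L \<subseteq> M \<Longrightarrow> integral_lagrangian_torus M L" "\<And>k l. L \<inter> product_torus k l = {}"
proof -
  define \<eta> where "\<eta> = min \<epsilon> 1 / 4"
  define \<delta> where "\<delta> = \<eta> / 50"
  have *: "0 < \<delta>" "50 * \<delta> \<le> \<eta>" "4 * \<eta> \<le> 1" "4 * \<eta> \<le> \<epsilon>"
    using assms by (auto simp: \<delta>_def \<eta>_def)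
  obtain x y x' y' G where "unit_area_curve \<delta> x y x' y' G"
    using unit_area_curve_exists[OF *(1)] by blast
  then interpret twisted_torus \<delta> x y x' y' G \<eta>
    using * by (simp add: twisted_torus_def twisted_torus_axioms_def)
  show ?thesis
  proof (rule that[of "range torus"])
    show "range torus \<subseteq> polydisk (2 + \<epsilon>) (2 + \<epsilon>)"
      using range_torus_subset polydisk_mono[of "2 + 4 * \<eta>" "2 + \<epsilon>" "2 + 4 * \<eta>" "2 + \<epsilon>"] *(4) by simp
  qed (simp_all add: integral_lagrangian_torus_range range_torus_disjoint)
qed

theorem theorem1p2:
  fixes a b :: real
  assumes "min a b > 2"
  shows "\<not> maximal_integral_packing (polydisk a b) (product_tori a b)
    \<and> (\<exists>L. integral_lagrangian_torus (polydisk a b) L \<and> (\<forall>L'\<in>product_tori a b. L \<inter> L' = {}))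
    \<and> (\<forall>\<epsilon>>0. \<exists>L. integral_lagrangian_torus (polydisk (2 + \<epsilon>) (2 + \<epsilon>)) L \<and>
          L \<subseteq> polydisk (2 + \<epsilon>) (2 + \<epsilon>) - (\<Union>k\<in>{1, 2}. \<Union>l\<in>{1, 2}. product_torus k l))"
proof (intro conjI allI impI)
  obtain L where L: "L \<noteq> {}" "L \<subseteq> polydisk (2 + (min a b - 2)) (2 + (min a b - 2))"
    "\<And>M. L \<subseteq> M \<Longrightarrow> integral_lagrangian_torus M L" "\<And>k l. L \<inter> product_torus k l = {}"
    using integral_torus_disjoint_from_product_tori[of "min a b - 2"] assms by auto
  have "L \<subseteq> polydisk a b" using L(2) by (auto simp: polydisk_def)
  then have int: "integral_lagrangian_torus (polydisk a b) L" by (rule L(3))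
  moreover have disj: "\<forall>L'\<in>product_tori a b. L \<inter> L' = {}"
    using L(4) by (auto simp: product_tori_def)
  ultimately show "\<exists>L. integral_lagrangian_torus (polydisk a b) L \<and> (\<forall>L'\<in>product_tori a b. L \<inter> L' = {})"
    by blast
  have "L \<notin> product_tori a b" using disj L(1) by blast
  then show "\<not> maximal_integral_packing (polydisk a b) (product_tori a b)"
    unfolding maximal_integral_packing_def using int disj by blast
next
  fix \<epsilon> :: real assume "\<epsilon> > 0"
  then obtain L where L: "L \<subseteq> polydisk (2 + \<epsilon>) (2 + \<epsilon>)"
    "\<And>M. L \<subseteq> M \<Longrightarrow> integral_lagrangian_torus M L" "\<And>k l. L \<inter> product_torus k l = {}"
    using integral_torus_disjoint_from_product_tori[of \<epsilon>] by metis
  have "L \<subseteq> polydisk (2 + \<epsilon>) (2 + \<epsilon>) - (\<Union>k\<in>{1, 2}. \<Union>l\<in>{1, 2}. product_torus k l)"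
    using L(1,3) by blast
  with L(2)[OF L(1)] show "\<exists>L. integral_lagrangian_torus (polydisk (2 + \<epsilon>) (2 + \<epsilon>)) L \<and>
      L \<subseteq> polydisk (2 + \<epsilon>) (2 + \<epsilon>) - (\<Union>k\<in>{1, 2}. \<Union>l\<in>{1, 2}. product_torus k l)"
    by blast
qed

end
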